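(* Let $a,\tilde a\in C^\infty(\mathbb R\times\mathbb R^n)$ both satisfy the standing conditions below (with the same known quantities). If $\Gamma_a=\Gamma_{\tilde a}$, then $a(s,p)=\tilde a(s,p)$ on the open set $$\{(s,p)\in\mathbb R\times\mathbb R^n:\ |p|<\Pi(s)\},$$ where $\Pi:\mathbb R\to(0,\infty)$ is a positive continuous function which depends only on the known quantities.
   Context: Let $\Omega\subset\mathbb R^n$, $n\ge2$, be a smooth bounded domain; summation over repeated indices is assumed. A conductivity $a=a(s,p)\in C^\infty(\mathbb R\times\mathbb R^n)$ is required to satisfy: (Ellipticity) with $a_{ij}(s,p):=a\,\delta_{ij}+\tfrac12(\partial_{p_i}a\,p_j+\partial_{p_j}a\,p_i)$, one has $a_{ij}(s,p)\xi_i\xi_j\ge\lambda(s,p)|\xi|^2>0$ for all $(s,p)$ and all $\xi\in\mathbb R^n\setminus\{0\}$; (Coercivity) $\lambda(s,p)\ge\lambda_0(|s|)>0$ and $a(s,p)\ge1$; (Growth) $|p|\,|\nabla_pa|+|a|\le\mu_0(|s|)$ and $(1+|p|)|\partial_sa|\le\mu_0(|s|)\,|p|$. Here $\lambda_0$ is positive and non-increasing and $\mu_0$ is positive and non-decreasing in $|s|$. The "known quantities" are $\lambda,\lambda_0,\mu_0$, the domain $\Omega$, and bounds on the $C^k(K)$ seminorms of $a$ for all $k\ge0$ and all compact $K\subset\mathbb R\times\mathbb R^n$. For $f\in C^\infty(\partial\Omega)$, $u=u[f]\in C^\infty(\overline\Omega)$ denotes the solution of $\nabla\cdot(a(u,\nabla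 u)\nabla u)=0$ in $\Omega$, $u|_{\partial\Omega}=f$. The Dirichlet-to-Neumann map is $\Gamma_a(f)=a(u,\nabla u)\,\frac{\partial u}{\partial\nu}\,dS$, where $\nu$ is the Euclidean unit normal to $\partial\Omega$ and $dS$ the Euclidean area form on $\partial\Omega$. *)

theory Defs
  imports "HOL-Analysis.Analysis"
begin

fun dderiv :: "('a::real_normed_vector \<Rightarrow> real) \<Rightarrow> 'a list \<Rightarrow> 'a \<Rightarrow> real" where
  "dderiv f [] = f"
| "dderiv f (v # vs) = (\<lambda>x. frechet_derivative (dderiv f vs) (at x) v)"

text \<open>C-infinity on the whole space: all iterated partial derivatives (along basis
  vectors) exist as Frechet derivatives everywhere (hence are continuous).\<close>
definition smooth :: "('a::euclidean_space \<Rightarrow> real) \<Rightarrow> bool" where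
  "smooth f \<longleftrightarrow> (\<forall>vs x. set vs \<subseteq> Basis \<longrightarrow> dderiv f vs differentiable (at x))"

definition grad :: "(real^'n \<Rightarrow> real) \<Rightarrow> real^'n \<Rightarrow> real^'n" where
  "grad u x = (\<chi> i. frechet_derivative u (at x) (axis i 1))"

definition div_field :: "(real^'n \<Rightarrow> real^'n) \<Rightarrow> real^'n \<Rightarrow> real" where
  "div_field V x = (\<Sum>i\<in>UNIV. frechet_derivative (\<lambda>y. V y $ i) (at x) (axis i 1))"

definition defining_function :: "(real^'n \<Rightarrow> real) \<Rightarrow> (real^'n) set \<Rightarrow> bool" where
  "defining_function \<rho> \<Omega> \<longleftrightarrow> smooth \<rho> \<and> \<Omega> = {x. \<rho> x < 0} \<and>
     (\<forall>x. \<rho> x = 0 \<longrightarrow> grad \<rho> x \<noteq> 0)"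

definition smooth_bounded_domain :: "(real^'n) set \<Rightarrow> bool" where
  "smooth_bounded_domain \<Omega> \<longleftrightarrow> open \<Omega> \<and> bounded \<Omega> \<and> connected \<Omega> \<and> \<Omega> \<noteq> {} \<and>
     (\<exists>\<rho>. defining_function \<rho> \<Omega>)"

text \<open>Euclidean outward unit normal on the boundary (independent of the defining function).\<close>
definition outer_normal :: "(real^'n) set \<Rightarrow> real^'n \<Rightarrow> real^'n" where
  "outer_normal \<Omega> x = (let \<rho> = (SOME \<rho>. defining_function \<rho> \<Omega>) in
     (1 / norm (grad \<rho> x)) *\<^sub>R grad \<rho> x)"

definition ds :: "(real \<times> (real^'n) \<Rightarrow> real) \<Rightarrow> real \<times> (real^'n) \<Rightarrow> real" where
  "ds a z = frechet_derivative a (at z) (1, 0)"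

definition dp :: "(real \<times> (real^'n) \<Rightarrow> real) \<Rightarrow> real \<times> (real^'n) \<Rightarrow> real^'n" where
  "dp a z = (\<chi> i. frechet_derivative a (at z) (0, axis i 1))"

definition acoef :: "(real \<times> (real^'n) \<Rightarrow> real) \<Rightarrow> real \<times> (real^'n) \<Rightarrow> 'n \<Rightarrow> 'n \<Rightarrow> real" where
  "acoef a z i j = a z * (if i = j then 1 else 0)
      + (dp a z $ i * snd z $ j + dp a z $ j * snd z $ i) / 2"

text \<open>The standing conditions on a conductivity, with known quantities
  lam, lam0, mu0 and seminorm bounds B (B k K bounds the C^k(K) seminorm).\<close>
definition admissible ::
  "(real \<times> (real^'n) \<Rightarrow> real) \<Rightarrow> (real \<Rightarrow> real) \<Rightarrow> (real \<Rightarrow> real)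
   \<Rightarrow> (nat \<Rightarrow> (real \<times> (real^'n)) set \<Rightarrow> real) \<Rightarrow> (real \<times> (real^'n) \<Rightarrow> real) \<Rightarrow> bool" where
  "admissible lam lam0 mu0 B a \<longleftrightarrow>
     smooth a
   \<and> (\<forall>s p. lam (s, p) > 0 \<and>
        (\<forall>\<xi>::real^'n. \<xi> \<noteq> 0 \<longrightarrow>
           (\<Sum>i\<in>UNIV. \<Sum>j\<in>UNIV. acoef a (s, p) i j * \<xi> $ i * \<xi> $ j) \<ge> lam (s, p) * (norm \<xi>)\<^sup>2))
   \<and> (\<forall>s p. lam (s, p) \<ge> lam0 \<bar>s\<bar> \<and> a (s, p) \<ge> 1)
   \<and> (\<forall>s p. norm p * norm (dp a (s, p)) + \<bar>a (s, p)\<bar> \<le> mu0 \<bar>s\<bar>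
          \<and> (1 + norm p) * \<bar>ds a (s, p)\<bar> \<le> mu0 \<bar>s\<bar> * norm p)
   \<and> (\<forall>k K. compact K \<longrightarrow> (\<forall>vs z. set vs \<subseteq> Basis \<and> length vs \<le> k \<and> z \<in> K
          \<longrightarrow> \<bar>dderiv a vs z\<bar> \<le> B k K))"

text \<open>U (a smooth function on R^n, restricted to the closure of Omega) solves
  div(a(u, grad u) grad u) = 0 in Omega with u = f on the boundary.\<close>
definition is_solution :: "(real^'n) set \<Rightarrow> (real \<times> (real^'n) \<Rightarrow> real)
     \<Rightarrow> (real^'n \<Rightarrow> real) \<Rightarrow> (real^'n \<Rightarrow> real) \<Rightarrow> bool" where
  "is_solution \<Omega> a f u \<longleftrightarrow> smooth u
     \<and> (\<forall>x\<in>\<Omega>. div_field (\<lambda>y. a (u y, grad u y) *\<^sub>R grad u y) x = 0)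
     \<and> (\<forall>x\<in>frontier \<Omega>. u x = f x)"

text \<open>Dirichlet-to-Neumann map, as density with respect to the Euclidean area form dS
  on the boundary: Gamma_a(f) = dn_map \<Omega> a f \<cdot> dS, with u = u[f] the solution.\<close>
definition dn_map :: "(real^'n) set \<Rightarrow> (real \<times> (real^'n) \<Rightarrow> real)
     \<Rightarrow> (real^'n \<Rightarrow> real) \<Rightarrow> real^'n \<Rightarrow> real" where
  "dn_map \<Omega> a f x = (let u = (SOME u. is_solution \<Omega> a f u) in
     a (u x, grad u x) * (grad u x \<bullet> outer_normal \<Omega> x))"

end

theory Submission
  imports Defs
begin

text \<open>
  The proof compares planar solutions. For a unit vector \<open>e\<close> and \<open>c > 0\<close> the equation has the
  solutions \<open>w(e \<bullet> x)\<close> with \<open>a(w, w' e) w' = c\<close>, whose flux is the constant vector \<open>c e\<close>.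
  Take the boundary values of such a solution for \<open>a\<close>. If the Dirichlet-to-Neumann maps coincide, the
  solution \<open>u\<close> for \<open>a'\<close> with these boundary values has the Neumann data of a planar solution for
  \<open>a'\<close> with flux \<open>c e\<close>. Solutions with equal Neumann data whose difference vanishes at a point
  coincide, so \<open>u\<close> is planar itself, its profile is \<open>w\<close>, and \<open>a = a'\<close> along \<open>(w, w' e)\<close>.
  These curves reach every \<open>(s, p)\<close> with \<open>p \<noteq> 0\<close>, so \<open>\<Pi>\<close> may be any positive function.

  Uniqueness rests on one estimate. If the boundary terms cancel, testing the equation of the difference
  \<open>d\<close> with \<open>arctan (d / \<delta>) / \<delta>\<close> bounds the integral of \<open>|grad d|\<^sup>2 / (d\<^sup>2 + \<delta>\<^sup>2)\<close> uniformly in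
  \<open>\<delta>\<close>, while a Poincare inequality for \<open>ln (1 + d\<^sup>2 / \<delta>\<^sup>2)\<close> or \<open>arsinh (d / \<delta>)\<close>
  would make it blow up as \<open>\<delta>\<close> tends to 0.

  No existence theorem for the Dirichlet problem is needed: data without a solution for \<open>a'\<close> can
  occur for at most one flux vector \<open>c e\<close>, which is removed by continuity.
\<close>

text \<open>The obstacle is the dependence of \<open>a\<close> on \<open>s\<close>. With
  \<open>X\<close> the difference of the two fluxes, ellipticity gives only
  \<open>m |grad d|^2 - K |d| |grad d| <= grad d . X\<close>, and the term with \<open>K\<close> has
  no sign, so testing with \<open>d\<close> itself is inconclusive. After division by
  \<open>d^2 + \<delta>^2\<close> that term is absorbed up to a constant independent of
  \<open>\<delta>\<close>. What remains is an energy bound for a logarithm of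
  \<open>d / \<delta>\<close>: between a zero of \<open>d\<close> and a nonzero value, or between
  values of opposite sign, this logarithm would have to change by an amount that grows without bound
  as \<open>\<delta>\<close> shrinks. This takes the place of a maximum principle and of unique
  continuation. Planar solutions fit because their flux retains nothing of the conductivity except
  the number \<open>c\<close>: profiles for \<open>a\<close> and for \<open>a'\<close> with the same
  \<open>c\<close> share their Neumann data, although the profiles themselves may differ.\<close>

section \<open>Calculus of continuously differentiable functions\<close>

abbreviation fderiv :: "('a::real_normed_vector \<Rightarrow> real) \<Rightarrow> 'a \<Rightarrow> 'a \<Rightarrow> real" where
  "fderiv f x \<equiv> frechet_derivative f (at x)"

text \<open>Continuity is asked direction by direction. In finite dimension this amounts to
  continuity of the derivative as a linear map, and it keeps all integrands scalar.\<close>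

definition C1 :: "('a::euclidean_space \<Rightarrow> real) \<Rightarrow> bool" where
  "C1 f \<longleftrightarrow> (\<forall>x. f differentiable (at x)) \<and> (\<forall>v. continuous_on UNIV (\<lambda>x. fderiv f x v))"

lemma C1I:
  assumes "\<And>x. (f has_derivative f' x) (at x)" "\<And>v. continuous_on UNIV (\<lambda>x. f' x v)"
  shows "C1 f"
proof -
  have "fderiv f x = f' x" for x
    using frechet_derivative_at[OF assms(1)] by simp
  then show ?thesis
    unfolding C1_def using assms by (auto simp: differentiable_def)
qed

lemma C1_has_derivative: "C1 f \<Longrightarrow> (f has_derivative fderiv f x) (at x)"
  by (simp add: C1_def frechet_derivative_works)

lemma fderiv_eq: "(f has_derivative f') (at x) \<Longrightarrow> fderiv f x = f'"
  by (rule frechet_derivative_at[symmetric])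

lemma C1_continuous_fderiv: "C1 f \<Longrightarrow> continuous_on S (\<lambda>x. fderiv f x v)"
  unfolding C1_def by (blast intro: continuous_on_subset[OF _ subset_UNIV])

lemma C1_continuous: "C1 f \<Longrightarrow> continuous_on S f"
  unfolding C1_def by (simp add: continuous_at_imp_continuous_on differentiable_imp_continuous_within)

lemma fderiv_linear: "C1 f \<Longrightarrow> linear (fderiv f x)"
  by (rule has_derivative_linear[OF C1_has_derivative])

lemma fderiv_sum_Basis:
  "C1 f \<Longrightarrow> fderiv f x v = (\<Sum>b\<in>Basis. (v \<bullet> b) * fderiv f x b)"
proof -
  assume "C1 f"
  then have l: "linear (fderiv f x)" by (rule fderiv_linear)
  have "fderiv f x v = fderiv f x (\<Sum>b\<in>Basis. (v \<bullet> b) *\<^sub>R b)"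
    by (simp add: euclidean_representation)
  also have "\<dots> = (\<Sum>b\<in>Basis. (v \<bullet> b) * fderiv f x b)"
    using l by (simp add: linear_sum linear_cmul)
  finally show ?thesis .
qed

lemma C1_const: "C1 (\<lambda>x. c)"
  by (rule C1I[of _ "\<lambda>_ _. 0"]) auto

lemma C1_inner: "C1 (\<lambda>x. e \<bullet> x)"
  by (rule C1I[of _ "\<lambda>_ v. e \<bullet> v"]) (auto intro!: derivative_eq_intros)

lemma C1_mult:
  assumes "C1 f" "C1 g"
  shows "C1 (\<lambda>x. f x * g x)"
  by (rule C1I[of _ "\<lambda>x v. f x * fderiv g x v + fderiv f x v * g x"])
     (auto intro!: has_derivative_mult C1_has_derivative continuous_intros C1_continuous_fderiv
        C1_continuous[OF assms(1)] C1_continuous[OF assms(2)] assms)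

lemma C1_diff:
  assumes "C1 f" "C1 g"
  shows "C1 (\<lambda>x. f x - g x)"
  by (rule C1I[of _ "\<lambda>x v. fderiv f x v - fderiv g x v"])
     (auto intro!: has_derivative_diff C1_has_derivative continuous_intros C1_continuous_fderiv assms)

lemma fderiv_diff: "C1 f \<Longrightarrow> C1 g \<Longrightarrow> fderiv (\<lambda>x. f x - g x) x v = fderiv f x v - fderiv g x v"
  by (subst fderiv_eq[OF has_derivative_diff[OF C1_has_derivative C1_has_derivative]]) auto

lemma fderiv_mult:
  "C1 f \<Longrightarrow> C1 g \<Longrightarrow> fderiv (\<lambda>x. f x * g x) x v = f x * fderiv g x v + fderiv f x v * g x"
  by (subst fderiv_eq[OF has_derivative_mult[OF C1_has_derivative C1_has_derivative]]) auto

lemma fderiv_inner: "fderiv (\<lambda>x. e \<bullet> x) x v = e \<bullet> v"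
proof -
  have "((\<lambda>x. e \<bullet> x) has_derivative (\<lambda>v. e \<bullet> v)) (at x)"
    by (auto intro!: derivative_eq_intros)
  then show ?thesis by (simp add: fderiv_eq)
qed

lemma has_derivative_comp_real:
  assumes "\<And>y. (h has_real_derivative h' y) (at y)" "C1 f"
  shows "((\<lambda>x. h (f x)) has_derivative (\<lambda>v. h' (f x) * fderiv f x v)) (at x)"
  using has_derivative_compose[OF C1_has_derivative[OF assms(2)], of h "(*) (h' (f x))"] assms(1)
  by (simp add: has_field_derivative_def)

lemma C1_comp_real:
  assumes "\<And>y. (h has_real_derivative h' y) (at y)" "continuous_on UNIV h'" "C1 f"
  shows "C1 (\<lambda>x. h (f x))"
  by (rule C1I[of _ "\<lambda>x v. h' (f x) * fderiv f x v"])
     (auto intro!: has_derivative_comp_real assms continuous_intros C1_continuous_fderiv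
        continuous_on_compose2[OF assms(2)] C1_continuous[OF assms(3)])

lemma fderiv_comp_real:
  assumes "\<And>y. (h has_real_derivative h' y) (at y)" "C1 f"
  shows "fderiv (\<lambda>x. h (f x)) x v = h' (f x) * fderiv f x v"
  by (simp add: fderiv_eq[OF has_derivative_comp_real[OF assms]])

text \<open>The direction \<open>h' x v\<close> moves with \<open>x\<close>, while \<open>C1\<close>
  speaks of fixed directions. Expanding it in the basis turns the derivative into a finite sum of
  products of continuous functions.\<close>

lemma C1_comp:
  fixes A :: "'b::euclidean_space \<Rightarrow> real" and h :: "'a::euclidean_space \<Rightarrow> 'b"
  assumes A: "C1 A" and h: "\<And>b. b \<in> Basis \<Longrightarrow> C1 (\<lambda>x. h x \<bullet> b)"
  shows "C1 (\<lambda>x. A (h x))"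
proof (rule C1I)
  define h' where "h' x v = (\<Sum>b\<in>Basis. fderiv (\<lambda>x. h x \<bullet> b) x v *\<^sub>R b)" for x v
  have 1: "(h has_derivative h' x) (at x)" for x
    unfolding has_derivative_componentwise_within[of h _ x UNIV, simplified]
    using C1_has_derivative[OF h] by (auto simp: h'_def inner_sum_left inner_Basis if_distrib cong: if_cong)
  show "((\<lambda>x. A (h x)) has_derivative (\<lambda>v. fderiv A (h x) (h' x v))) (at x)" for x
    by (rule has_derivative_compose[OF 1 C1_has_derivative[OF A]])
  have 2: "continuous_on UNIV h"
    using 1 by (meson continuous_at_imp_continuous_on has_derivative_continuous)
  have "fderiv A (h x) (h' x v) = (\<Sum>b\<in>Basis. fderiv (\<lambda>x. h x \<bullet> b) x v * fderiv A (h x) b)" for x v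
    unfolding fderiv_sum_Basis[OF A, of "h x" "h' x v"]
    by (simp add: h'_def inner_sum_left inner_Basis if_distrib cong: if_cong)
  moreover have "continuous_on UNIV (\<lambda>x. \<Sum>b\<in>Basis. fderiv (\<lambda>x. h x \<bullet> b) x v * fderiv A (h x) b)" for v
    by (intro continuous_intros C1_continuous_fderiv h
        continuous_on_compose2[OF C1_continuous_fderiv[OF A] 2]) auto
  ultimately show "continuous_on UNIV (\<lambda>x. fderiv A (h x) (h' x v))" for v
    by simp
qed

text \<open>\<open>smooth\<close> concerns basis directions only. By linearity a derivative in any
  direction is a combination of iterated derivatives with one more basis vector, and these are
  differentiable, hence continuous.\<close>

lemma smooth_C1_dderiv:
  assumes "smooth f" "set vs \<subseteq> Basis"
  shows "C1 (dderiv f vs)"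
proof -
  have d: "dderiv f ws differentiable (at x)" if "set ws \<subseteq> Basis" for ws x
    using assms that unfolding smooth_def by blast
  have c: "continuous_on UNIV (dderiv f ws)" if "set ws \<subseteq> Basis" for ws
    using d[OF that] by (meson continuous_at_imp_continuous_on differentiable_imp_continuous_within)
  show ?thesis
  proof (rule C1I)
    show h: "(dderiv f vs has_derivative fderiv (dderiv f vs) x) (at x)" for x
      using d[OF assms(2)] by (simp add: frechet_derivative_works)
    have "fderiv (dderiv f vs) x v = (\<Sum>b\<in>Basis. (v \<bullet> b) * dderiv f (b # vs) x)" for x v
    proof -
      have l: "linear (fderiv (dderiv f vs) x)" using h has_derivative_linear by blast
      have "fderiv (dderiv f vs) x v = fderiv (dderiv f vs) x (\<Sum>b\<in>Basis. (v \<bullet> b) *\<^sub>R b)"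
        by (simp add: euclidean_representation)
      also have "\<dots> = (\<Sum>b\<in>Basis. (v \<bullet> b) * fderiv (dderiv f vs) x b)"
        using l by (simp add: linear_sum linear_cmul)
      finally show ?thesis by simp
    qed
    moreover have "continuous_on UNIV (\<lambda>x. \<Sum>b\<in>Basis. (v \<bullet> b) * dderiv f (b # vs) x)" for v
      by (intro continuous_intros c) (use assms in auto)
    ultimately show "continuous_on UNIV (\<lambda>x. fderiv (dderiv f vs) x v)" for v
      by (simp del: dderiv.simps)
  qed
qed

lemma smooth_C1: "smooth f \<Longrightarrow> C1 f"
  using smooth_C1_dderiv[of f "[]"] by simp

section \<open>Integrals of derivatives of compactly supported functions\<close>

lemma integrable_compact_support:
  fixes f :: "'a::euclidean_space \<Rightarrow> real"
  assumes "continuous_on UNIV f" "\<And>x. x \<notin> cball 0 R \<Longrightarrow> f x = 0"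
  shows "integrable lborel f"
proof -
  have "integrable lborel (\<lambda>x. indicator (cball 0 R) x *\<^sub>R f x)"
    by (rule borel_integrable_compact[OF compact_cball continuous_on_subset[OF assms(1)]]) simp
  moreover have "(\<lambda>x. indicator (cball 0 R) x *\<^sub>R f x) = f"
    using assms(2) by (auto simp: indicator_def fun_eq_iff)
  ultimately show ?thesis by simp
qed

lemma integral_lborel_translate:
  fixes f :: "'a::euclidean_space \<Rightarrow> real"
  assumes "f \<in> borel_measurable borel"
  shows "(\<integral>x. f (x + c) \<partial>lborel) = (\<integral>x. f x \<partial>lborel)"
proof -
  have "(\<integral>x. f x \<partial>lborel) = (\<integral>x. f x \<partial>(distr lborel borel ((+) c)))"
    by (simp add: lborel_distr_plus)
  also have "\<dots> = (\<integral>x. f (c + x) \<partial>lborel)"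
    using assms by (subst integral_distr) auto
  finally show ?thesis by (simp add: add.commute)
qed

text \<open>Translation invariance makes every difference quotient \<open>s k\<close> integrate to
  zero, and dominated convergence carries this to the derivative.\<close>

lemma integral_fderiv_compact_support:
  fixes g :: "'a::euclidean_space \<Rightarrow> real"
  assumes g: "C1 g" and supp: "\<And>x. x \<notin> cball 0 R \<Longrightarrow> g x = 0"
  shows "(\<integral>x. fderiv g x v \<partial>lborel) = 0"
proof -
  define s where "s k x = real (Suc k) * (g (x + (1 / real (Suc k)) *\<^sub>R v) - g x)" for k x
  \<comment> \<open>One \<open>norm v\<close> covers all points where some \<open>s k\<close> can be
    nonzero; the second keeps the intermediate point of the mean value theorem inside
    \<open>K\<close>, where \<open>M\<close> bounds the derivative.\<close>
  define K where "K = cball (0::'a) (R + 2 * norm v)"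
  have cont: "continuous_on UNIV g" using g by (rule C1_continuous)
  have [measurable]: "g \<in> borel_measurable borel"
    using cont by (simp add: borel_measurable_continuous_onI)
  have [measurable]: "(\<lambda>x. fderiv g x v) \<in> borel_measurable borel"
    using C1_continuous_fderiv[OF g] by (simp add: borel_measurable_continuous_onI)
  have "compact ((\<lambda>x. fderiv g x v) ` K)"
    by (rule compact_continuous_image) (auto simp: K_def intro: C1_continuous_fderiv g)
  then have "bounded ((\<lambda>x. fderiv g x v) ` K)" by (rule compact_imp_bounded)
  then obtain M where M: "\<And>x. x \<in> K \<Longrightarrow> \<bar>fderiv g x v\<bar> \<le> M"
    unfolding bounded_iff by auto
  define w where "w x = indicator (cball (0::'a) (R + norm v)) x *\<^sub>R M" for x
  have int_g: "integrable lborel g" using integrable_compact_support[OF cont supp] .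
  have "(\<integral>x. s k x \<partial>lborel) = 0" for k
  proof -
    have "integrable lborel (\<lambda>x. g (x + (1 / real (Suc k)) *\<^sub>R v))"
    proof (rule integrable_compact_support[where R = "R + norm v"])
      show "continuous_on UNIV (\<lambda>x. g (x + (1 / real (Suc k)) *\<^sub>R v))"
        by (rule continuous_on_compose2[OF cont]) (auto intro!: continuous_intros)
      fix x :: 'a assume x: "x \<notin> cball 0 (R + norm v)"
      have "norm ((1 / real (Suc k)) *\<^sub>R v) \<le> norm v"
        by (simp add: divide_le_eq mult_le_cancel_left1)
      moreover have "norm x - norm ((1 / real (Suc k)) *\<^sub>R v) \<le> norm (x + (1 / real (Suc k)) *\<^sub>R v)"
        using norm_triangle_ineq4[of "x + (1 / real (Suc k)) *\<^sub>R v" "(1 / real (Suc k)) *\<^sub>R v"] by simp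
      ultimately show "g (x + (1 / real (Suc k)) *\<^sub>R v) = 0"
        using x by (intro supp) (auto simp del: norm_scaleR)
    qed
    then show ?thesis
      using int_g integral_lborel_translate[of g "(1 / real (Suc k)) *\<^sub>R v"] by (simp add: s_def del: of_nat_Suc)
  qed
  moreover have "(\<lambda>k. \<integral>x. s k x \<partial>lborel) \<longlonglongrightarrow> (\<integral>x. fderiv g x v \<partial>lborel)"
  proof (rule integral_dominated_convergence)
    show "integrable lborel w"
      unfolding w_def by (rule borel_integrable_compact) auto
    have "(\<lambda>k. s k x) \<longlonglongrightarrow> fderiv g x v" for x
    proof -
      have l: "linear (fderiv g x)" using fderiv_linear[OF g] .
      have "((\<lambda>t. x + t *\<^sub>R v) has_derivative (\<lambda>t. t *\<^sub>R v)) (at 0)"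
        by (auto intro!: derivative_eq_intros)
      from has_derivative_compose[OF this, of g "fderiv g x"] C1_has_derivative[OF g, of x]
      have "((\<lambda>t. g (x + t *\<^sub>R v)) has_real_derivative fderiv g x v) (at 0)"
        using l by (simp add: has_field_derivative_def linear_cmul mult_commute_abs)
      then have "((\<lambda>h. (g (x + h *\<^sub>R v) - g x) / h) \<longlongrightarrow> fderiv g x v) (at 0)"
        by (simp add: DERIV_def)
      moreover have "filterlim (\<lambda>k. 1 / real (Suc k)) (at 0) sequentially"
        unfolding filterlim_at using LIMSEQ_inverse_real_of_nat by (auto simp: divide_inverse)
      ultimately have "((\<lambda>k. (g (x + (1 / real (Suc k)) *\<^sub>R v) - g x) / (1 / real (Suc k))) \<longlonglongrightarrow> fderiv g x v)"
        by (rule filterlim_compose)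
      then show ?thesis by (simp add: s_def mult.commute del: of_nat_Suc)
    qed
    then show "AE x in lborel. (\<lambda>k. s k x) \<longlonglongrightarrow> fderiv g x v" by simp
    have "norm (s k x) \<le> w x" for k x
    proof -
      define h where "h = 1 / real (Suc k)"
      have h: "0 < h" "h \<le> 1" by (auto simp: h_def)
      show ?thesis
      proof (cases "x \<in> cball 0 (R + norm v)")
        case True
        have "\<exists>t. 0 < t \<and> t < h \<and> g (x + h *\<^sub>R v) - g (x + 0 *\<^sub>R v) = (h - 0) * fderiv g (x + t *\<^sub>R v) v"
        proof (rule MVT2)
          show "0 < h" by fact
          fix t
          have l: "linear (fderiv g (x + t *\<^sub>R v))" using fderiv_linear[OF g] .
          have "((\<lambda>t. x + t *\<^sub>R v) has_derivative (\<lambda>t. t *\<^sub>R v)) (at t)"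
            by (auto intro!: derivative_eq_intros)
          from has_derivative_compose[OF this C1_has_derivative[OF g]]
          show "((\<lambda>t. g (x + t *\<^sub>R v)) has_real_derivative fderiv g (x + t *\<^sub>R v) v) (at t)"
            using l by (simp add: has_field_derivative_def linear_cmul mult_commute_abs)
        qed
        then obtain t where t: "0 < t" "t < h" "g (x + h *\<^sub>R v) - g x = h * fderiv g (x + t *\<^sub>R v) v"
          by auto
        have "norm (t *\<^sub>R v) \<le> norm v" using t h by (simp add: mult_left_le_one_le)
        then have "x + t *\<^sub>R v \<in> K" using True norm_triangle_ineq[of x "t *\<^sub>R v"]
          by (auto simp: K_def)
        then have "\<bar>fderiv g (x + t *\<^sub>R v) v\<bar> \<le> M" by (rule M)
        moreover have "s k x = fderiv g (x + t *\<^sub>R v) v"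
        proof -
          have "s k x = real (Suc k) * (h * fderiv g (x + t *\<^sub>R v) v)"
            unfolding s_def h_def[symmetric] t(3) ..
          then show ?thesis by (simp add: h_def del: of_nat_Suc)
        qed
        ultimately show ?thesis using True by (simp add: w_def)
      next
        case False
        have n: "norm (h *\<^sub>R v) \<le> norm v"
          using h by (simp add: mult_left_le_one_le)
        have "norm x - norm (h *\<^sub>R v) \<le> norm (x + h *\<^sub>R v)"
          using norm_triangle_ineq4[of "x + h *\<^sub>R v" "h *\<^sub>R v"] by simp
        then have "g (x + h *\<^sub>R v) = 0"
          using False n by (intro supp) (auto simp del: norm_scaleR)
        moreover have "g x = 0" by (rule supp) (use False in \<open>smt (verit) mem_cball_0 norm_ge_zero\<close>)
        ultimately show ?thesis using False by (simp add: s_def h_def w_def)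
      qed
    qed
    then show "AE x in lborel. norm (s k x) \<le> w x" for k by simp
    show "s k \<in> borel_measurable lborel" for k unfolding s_def[abs_def] by measurable
  qed auto
  ultimately show ?thesis by (simp add: LIMSEQ_const_iff)
qed

section \<open>Integration by parts on a smooth bounded domain\<close>

definition C1_field :: "(real^'n \<Rightarrow> real^'n) \<Rightarrow> bool" where
  "C1_field X \<longleftrightarrow> (\<forall>i. C1 (\<lambda>x. X x $ i))"

lemma C1_field_continuous:
  assumes "C1_field X"
  shows "continuous_on S X"
proof -
  have "continuous_on S (\<lambda>x. \<chi> i. X x $ i)"
    using assms unfolding C1_field_def by (intro continuous_on_vec_lambda C1_continuous) auto
  then show ?thesis by simp
qed

lemma C1_field_continuous_div: "C1_field X \<Longrightarrow> continuous_on S (div_field X)"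
  unfolding div_field_def[abs_def] C1_field_def
  by (intro continuous_intros C1_continuous_fderiv) auto

lemma fderiv_grad:
  fixes f :: "real^'n \<Rightarrow> real"
  assumes "C1 f"
  shows "fderiv f x v = grad f x \<bullet> v"
proof -
  have l: "linear (fderiv f x)" using assms by (rule fderiv_linear)
  have "fderiv f x v = fderiv f x (\<Sum>i\<in>UNIV. v $ i *\<^sub>R axis i 1)"
    using basis_expansion[of v] by (simp add: scalar_mult_eq_scaleR)
  also have "\<dots> = (\<Sum>i\<in>UNIV. v $ i * fderiv f x (axis i 1))"
    using l by (simp add: linear_sum linear_cmul)
  finally show ?thesis by (simp add: grad_def inner_vec_def mult.commute)
qed

lemma smooth_C1_field_grad: "smooth f \<Longrightarrow> C1_field (grad f)"
  unfolding C1_field_def grad_def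
proof
  fix i assume "smooth f"
  then show "C1 (\<lambda>x. (\<chi> i. fderiv f x (axis i 1)) $ i)"
    using smooth_C1_dderiv[of f "[axis i 1]"] by (simp add: axis_in_Basis_iff)
qed

lemma fderiv_zero_outside:
  fixes g :: "'a::euclidean_space \<Rightarrow> real"
  assumes "\<And>x. x \<notin> cball 0 R \<Longrightarrow> g x = 0" "x \<notin> cball 0 R"
  shows "fderiv g x v = 0"
proof -
  have "(g has_derivative (\<lambda>v. 0)) (at x)"
    by (rule has_derivative_transform_within_open[of "\<lambda>_. 0" _ _ _ "- cball 0 R"]) (use assms in auto)
  then show ?thesis by (simp add: fderiv_eq)
qed

lemma integral_divergence_compact_support:
  fixes X :: "real^'n \<Rightarrow> real^'n"
  assumes psi: "C1 \<psi>" and X: "C1_field X" and supp: "\<And>x. x \<notin> cball 0 R \<Longrightarrow> \<psi> x = 0"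
  shows "(\<integral>x. fderiv \<psi> x (X x) + \<psi> x * div_field X x \<partial>lborel) = 0"
proof -
  have Xi: "C1 (\<lambda>x. X x $ i)" for i using X by (simp add: C1_field_def)
  have C: "C1 (\<lambda>x. \<psi> x * X x $ i)" for i by (intro C1_mult psi Xi)
  have "fderiv \<psi> x (X x) + \<psi> x * div_field X x = (\<Sum>i\<in>UNIV. fderiv (\<lambda>x. \<psi> x * X x $ i) x (axis i 1))" for x
    by (simp add: fderiv_mult[OF psi Xi] fderiv_grad[OF psi, of x "X x"] grad_def inner_vec_def
        div_field_def sum.distrib sum_distrib_left)
  then have "(\<integral>x. fderiv \<psi> x (X x) + \<psi> x * div_field X x \<partial>lborel)
     = (\<integral>x. (\<Sum>i\<in>UNIV. fderiv (\<lambda>x. \<psi> x * X x $ i) x (axis i 1)) \<partial>lborel)" by simp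
  also have "\<dots> = (\<Sum>i\<in>UNIV. \<integral>x. fderiv (\<lambda>x. \<psi> x * X x $ i) x (axis i 1) \<partial>lborel)"
  proof (rule Bochner_Integration.integral_sum)
    fix i :: 'n
    show "integrable lborel (\<lambda>x. fderiv (\<lambda>x. \<psi> x * X x $ i) x (axis i 1))"
    proof (rule integrable_compact_support)
      show "continuous_on UNIV (\<lambda>x. fderiv (\<lambda>x. \<psi> x * X x $ i) x (axis i 1))"
        by (rule C1_continuous_fderiv[OF C])
      show "\<And>x. x \<notin> cball 0 R \<Longrightarrow> fderiv (\<lambda>x. \<psi> x * X x $ i) x (axis i 1) = 0"
        by (rule fderiv_zero_outside[where R = R]) (use supp in auto)
    qed
  qed
  also have "\<dots> = 0"
    using supp by (intro sum.neutral ballI integral_fderiv_compact_support[OF C, where R = R]) auto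
  finally show ?thesis .
qed

section \<open>Cutoff functions for the boundary layer\<close>

text \<open>Composed with \<open>- \<rho>\<close>, this approximates the indicator of the domain
  from inside as \<epsilon> tends to 0. The rational form keeps it continuously differentiable and
  makes the estimates of its derivative elementary.\<close>

definition cutoff :: "real \<Rightarrow> real \<Rightarrow> real" where
  "cutoff \<epsilon> t = (max t 0)\<^sup>2 / ((max t 0)\<^sup>2 + \<epsilon>\<^sup>2)"

definition cutoff' :: "real \<Rightarrow> real \<Rightarrow> real" where
  "cutoff' \<epsilon> t = 2 * max t 0 * \<epsilon>\<^sup>2 / ((max t 0)\<^sup>2 + \<epsilon>\<^sup>2)\<^sup>2"

text \<open>Squaring removes the corner of the positive part at 0; \<open>cutoff\<close> inherits
  its differentiability from here.\<close>

lemma has_derivative_pos_part_square: "((\<lambda>t::real. (max t 0)\<^sup>2) has_real_derivative 2 * max t 0) (at t)"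
proof -
  consider "t < 0" | "t > 0" | "t = 0" by linarith
  then show ?thesis
  proof cases
    case 1
    have "((\<lambda>t::real. (max t 0)\<^sup>2) has_real_derivative 0) (at t)"
      by (rule has_field_derivative_transform_within_open[where S = "{..<0}" and f = "\<lambda>_. 0"]) (use 1 in auto)
    then show ?thesis using 1 by (simp add: max_def)
  next
    case 2
    have "((\<lambda>t::real. (max t 0)\<^sup>2) has_real_derivative 2 * t) (at t)"
      by (rule has_field_derivative_transform_within_open[where S = "{0<..}" and f = "\<lambda>t. t\<^sup>2"])
         (use 2 in \<open>auto simp: max_def intro!: derivative_eq_intros\<close>)
    then show ?thesis using 2 by (simp add: max_def)
  next
    case 3
    have "((\<lambda>h::real. max h 0) \<longlongrightarrow> max 0 0) (at 0)"
      by (intro tendsto_intros)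
    then have "((\<lambda>h::real. max h 0) \<longlongrightarrow> 0) (at 0)" by simp
    then have "((\<lambda>h::real. ((max (0 + h) 0)\<^sup>2 - (max 0 0)\<^sup>2) / h) \<longlongrightarrow> 0) (at 0)"
      by (rule Lim_transform_eventually)
         (auto simp: eventually_at_filter max_def power2_eq_square)
    then show ?thesis using 3 by (simp add: DERIV_def)
  qed
qed

lemma DERIV_cutoff:
  assumes "\<epsilon> > 0"
  shows "(cutoff \<epsilon> has_real_derivative cutoff' \<epsilon> t) (at t)"
proof -
  have "(max t 0)\<^sup>2 + \<epsilon>\<^sup>2 > 0" using assms by (simp add: add_nonneg_pos)
  then have "(cutoff \<epsilon> has_real_derivative
    (2 * max t 0 * ((max t 0)\<^sup>2 + \<epsilon>\<^sup>2) - (max t 0)\<^sup>2 * (2 * max t 0)) / (((max t 0)\<^sup>2 + \<epsilon>\<^sup>2) * ((max t 0)\<^sup>2 + \<epsilon>\<^sup>2))) (at t)"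
    unfolding cutoff_def[abs_def]
    by (intro DERIV_divide has_derivative_pos_part_square DERIV_add[OF has_derivative_pos_part_square DERIV_const, simplified])
      auto
  then show ?thesis
    by (simp add: cutoff'_def power2_eq_square algebra_simps)
qed

lemma continuous_cutoff': "\<epsilon> > 0 \<Longrightarrow> continuous_on UNIV (cutoff' \<epsilon>)"
  unfolding cutoff'_def[abs_def] by (intro continuous_intros) (auto simp: add_nonneg_eq_0_iff)

lemma cutoff_bounds: "0 \<le> cutoff \<epsilon> t" "cutoff \<epsilon> t \<le> 1"
proof -
  have "p / (p + q) \<le> 1" if "p \<ge> 0" "q \<ge> 0" for p q :: real
    using that by (cases "p + q = 0") (simp_all add: divide_le_eq_1)
  then show "cutoff \<epsilon> t \<le> 1" unfolding cutoff_def by (meson zero_le_power2)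
  show "0 \<le> cutoff \<epsilon> t" unfolding cutoff_def by (intro divide_nonneg_nonneg add_nonneg_nonneg zero_le_power2)
qed

lemma cutoff_nonpos [simp]: "t \<le> 0 \<Longrightarrow> cutoff \<epsilon> t = 0" "t \<le> 0 \<Longrightarrow> cutoff' \<epsilon> t = 0"
  by (auto simp: cutoff_def cutoff'_def)

lemma cutoff'_nonneg: "0 \<le> cutoff' \<epsilon> t"
  unfolding cutoff'_def by (intro divide_nonneg_nonneg mult_nonneg_nonneg zero_le_power2) simp_all

text \<open>The inequality between arithmetic and geometric mean bounds
  \<open>2 * t * \<epsilon>\<close>, and \<open>t^2\<close> is bounded trivially, by the same sum of
  squares. The estimate makes every part of a boundary term that is quadratic in
  \<open>\<rho>\<close> vanish in the limit.\<close>

lemma cutoff'_mult_square: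
  assumes "\<epsilon> > 0"
  shows "cutoff' \<epsilon> t * t\<^sup>2 \<le> \<epsilon>"
proof (cases "t > 0")
  case True
  have "2 * t * \<epsilon> \<le> t\<^sup>2 + \<epsilon>\<^sup>2" using sum_squares_bound by blast
  then have "t\<^sup>2 * (2 * t * \<epsilon>) \<le> (t\<^sup>2 + \<epsilon>\<^sup>2) * (t\<^sup>2 + \<epsilon>\<^sup>2)"
    using True assms by (intro mult_mono) auto
  then have "\<epsilon> * (t\<^sup>2 * (2 * t * \<epsilon>)) \<le> \<epsilon> * (t\<^sup>2 + \<epsilon>\<^sup>2)\<^sup>2"
    using assms by (simp add: power2_eq_square)
  moreover have "t\<^sup>2 + \<epsilon>\<^sup>2 > 0" using True by (simp add: add_pos_nonneg)
  ultimately show ?thesis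
    using True by (simp add: cutoff'_def divide_le_eq power2_eq_square ac_simps)
next
  case False
  then show ?thesis using assms by simp
qed

lemma cutoff_tendsto:
  assumes "t > 0"
  shows "(\<lambda>k. cutoff (1 / real (Suc k)) t) \<longlonglongrightarrow> 1"
proof -
  have "(\<lambda>k. 1 / real (Suc k)) \<longlonglongrightarrow> 0"
    using LIMSEQ_inverse_real_of_nat by (simp add: divide_inverse)
  then have "(\<lambda>k. t\<^sup>2 / (t\<^sup>2 + (1 / real (Suc k))\<^sup>2)) \<longlonglongrightarrow> t\<^sup>2 / (t\<^sup>2 + 0\<^sup>2)"
    using assms by (intro tendsto_intros) auto
  then show ?thesis using assms by (simp add: cutoff_def max_def)
qed

text \<open>Boundary terms are expressed through \<open>grad \<rho>\<close> instead of a unit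
  normal. The choice of \<rho> is free here; later it is the one that \<open>outer_normal\<close>
  picks.\<close>

locale level_domain =
  fixes \<Omega> :: "(real^'n) set" and \<rho> :: "real^'n \<Rightarrow> real"
  assumes bounded: "bounded \<Omega>" and defining: "defining_function \<rho> \<Omega>"
begin

lemma C1_rho: "C1 \<rho>" and C1_grad_rho: "C1_field (grad \<rho>)"
  using defining smooth_C1 smooth_C1_field_grad unfolding defining_function_def by auto

lemma mem_iff: "x \<in> \<Omega> \<longleftrightarrow> \<rho> x < 0"
  using defining unfolding defining_function_def by auto

lemma open_domain: "open \<Omega>"
proof -
  have "\<Omega> = {x. \<rho> x < 0}" using mem_iff by auto
  then show ?thesis
    using open_Collect_less[of \<rho> "\<lambda>_. 0"] C1_continuous[OF C1_rho] by simp
qed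

lemma rho_frontier: "x \<in> frontier \<Omega> \<Longrightarrow> \<rho> x = 0"
proof -
  assume x: "x \<in> frontier \<Omega>"
  have "closed {x. \<rho> x \<le> 0}"
    using C1_continuous[OF C1_rho] by (intro closed_Collect_le) auto
  moreover have "\<Omega> \<subseteq> {x. \<rho> x \<le> 0}" using mem_iff by auto
  ultimately have "closure \<Omega> \<subseteq> {x. \<rho> x \<le> 0}" by (simp add: closure_minimal)
  moreover have "x \<notin> \<Omega>" "x \<in> closure \<Omega>"
    using x open_domain by (auto simp: frontier_def interior_open)
  ultimately show ?thesis using mem_iff[of x] by (auto simp: not_less)
qed

lemma grad_rho_frontier: "x \<in> frontier \<Omega> \<Longrightarrow> grad \<rho> x \<noteq> 0"
  using rho_frontier defining unfolding defining_function_def by auto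

lemma compact_closure_domain: "compact (closure \<Omega>)"
  using bounded by (simp add: compact_closure)

lemma closure_cases: "x \<in> closure \<Omega> \<Longrightarrow> x \<in> \<Omega> \<or> x \<in> frontier \<Omega>"
  using open_domain by (auto simp: frontier_def interior_open)

lemma set_integrable_continuous:
  fixes f :: "real^'n \<Rightarrow> real"
  assumes "continuous_on (closure \<Omega>) f"
  shows "set_integrable lborel \<Omega> f"
proof (rule set_integrable_subset)
  show "set_integrable lborel (closure \<Omega>) f"
    unfolding set_integrable_def using borel_integrable_compact[OF compact_closure_domain assms] .
qed (use open_domain closure_subset in auto)

lemma bounded_on_closure:
  fixes f :: "real^'n \<Rightarrow> 'b::real_normed_vector"
  assumes "continuous_on (closure \<Omega>) f"
  obtains M where "M \<ge> 0" "\<And>x. x \<in> closure \<Omega> \<Longrightarrow> norm (f x) \<le> M"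
proof -
  have "bounded (f ` closure \<Omega>)"
    using compact_continuous_image[OF assms compact_closure_domain] compact_imp_bounded by blast
  then obtain M where "\<forall>y\<in>f ` closure \<Omega>. norm y \<le> M" unfolding bounded_iff by blast
  then show ?thesis using that[of "max M 0"] by fastforce
qed

lemma supp_radius: obtains R where "\<And>x. x \<notin> cball 0 R \<Longrightarrow> x \<notin> \<Omega>"
proof -
  obtain M where "\<forall>x\<in>\<Omega>. norm x \<le> M" using bounded unfolding bounded_iff by blast
  then show ?thesis using that[of M] by auto
qed

lemma C1_cutoff: "\<epsilon> > 0 \<Longrightarrow> C1 (\<lambda>x. cutoff \<epsilon> (- \<rho> x))"
  using C1_comp_real[OF DERIV_cutoff continuous_cutoff', of \<epsilon> "\<lambda>x. 0 - \<rho> x"] C1_diff[OF C1_const C1_rho, of 0] by simp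

lemma fderiv_cutoff: "\<epsilon> > 0 \<Longrightarrow> fderiv (\<lambda>x. cutoff \<epsilon> (- \<rho> x)) x v = - cutoff' \<epsilon> (- \<rho> x) * fderiv \<rho> x v"
  using fderiv_comp_real[OF DERIV_cutoff, of \<epsilon> "\<lambda>x. 0 - \<rho> x" x v] C1_diff[OF C1_const C1_rho, of 0]
    fderiv_diff[OF C1_const C1_rho, of 0 x v] by simp

lemma continuous_cutoff'_rho: "\<epsilon> > 0 \<Longrightarrow> continuous_on S (\<lambda>x. cutoff' \<epsilon> (- \<rho> x))"
  by (rule continuous_on_compose2[OF continuous_cutoff'])
     (auto intro!: continuous_intros C1_continuous[OF C1_rho])

lemma integrable_vanish_outside:
  fixes f :: "real^'n \<Rightarrow> real"
  assumes "continuous_on UNIV f" "\<And>x. x \<notin> \<Omega> \<Longrightarrow> f x = 0"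
  shows "integrable lborel f"
proof -
  obtain R where "\<And>x. x \<notin> cball 0 R \<Longrightarrow> x \<notin> \<Omega>" using supp_radius by blast
  then show ?thesis using integrable_compact_support[OF assms(1), of R] assms(2) by blast
qed

text \<open>The divergence of the compactly supported field \<open>cutoff * \<phi> * X\<close>
  integrates to zero. The derivative of the cutoff lives in a layer that shrinks to the frontier
  with \<epsilon>, so the right-hand side stands for the boundary integral.\<close>

lemma cutoff_identity:
  assumes eps: "\<epsilon> > 0" and phi: "C1 \<phi>" and X: "C1_field X"
  shows "(\<integral>x. cutoff \<epsilon> (- \<rho> x) * (fderiv \<phi> x (X x) + \<phi> x * div_field X x) \<partial>lborel)
       = (\<integral>x. cutoff' \<epsilon> (- \<rho> x) * (\<phi> x * (grad \<rho> x \<bullet> X x)) \<partial>lborel)"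
proof -
  let ?c = "\<lambda>x. cutoff \<epsilon> (- \<rho> x)"
  obtain R where R: "\<And>x. x \<notin> cball 0 R \<Longrightarrow> x \<notin> \<Omega>" using supp_radius by blast
  have z: "?c x = 0" "cutoff' \<epsilon> (- \<rho> x) = 0" if "x \<notin> \<Omega>" for x using that mem_iff[of x] by auto
  have "(\<integral>x. fderiv (\<lambda>x. ?c x * \<phi> x) x (X x) + (?c x * \<phi> x) * div_field X x \<partial>lborel) = 0"
    by (rule integral_divergence_compact_support[where R = R, OF C1_mult[OF C1_cutoff[OF eps] phi] X])
       (use R z in auto)
  moreover have "fderiv (\<lambda>x. ?c x * \<phi> x) x (X x) + (?c x * \<phi> x) * div_field X x
     = ?c x * (fderiv \<phi> x (X x) + \<phi> x * div_field X x) - cutoff' \<epsilon> (- \<rho> x) * (\<phi> x * (grad \<rho> x \<bullet> X x))" for x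
    unfolding fderiv_mult[OF C1_cutoff[OF eps] phi] fderiv_cutoff[OF eps] fderiv_grad[OF C1_rho]
    by (simp add: algebra_simps)
  moreover have "integrable lborel (\<lambda>x. ?c x * (fderiv \<phi> x (X x) + \<phi> x * div_field X x))"
  proof (rule integrable_vanish_outside)
    have "fderiv \<phi> x (X x) = (\<Sum>i\<in>UNIV. fderiv \<phi> x (axis i 1) * X x $ i)" for x
      by (simp add: fderiv_grad[OF phi, of x "X x"] grad_def inner_vec_def)
    then show "continuous_on UNIV (\<lambda>x. ?c x * (fderiv \<phi> x (X x) + \<phi> x * div_field X x))"
      by (simp, intro continuous_intros C1_continuous[OF C1_cutoff[OF eps]] C1_continuous[OF phi]
         C1_field_continuous_div[OF X] C1_continuous_fderiv[OF phi] continuous_on_component C1_field_continuous[OF X])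
  qed (use z in auto)
  moreover have "integrable lborel (\<lambda>x. cutoff' \<epsilon> (- \<rho> x) * (\<phi> x * (grad \<rho> x \<bullet> X x)))"
    by (rule integrable_vanish_outside)
       (use z in \<open>auto intro!: continuous_intros continuous_cutoff'_rho[OF eps] C1_continuous[OF phi]
         C1_field_continuous[OF X] C1_field_continuous[OF C1_grad_rho]\<close>)
  ultimately show ?thesis by simp
qed

text \<open>Testing with the field \<open>grad \<rho>\<close> itself controls the boundary layer, so no surface measure or
  tubular neighbourhood is needed.\<close>

lemma cutoff_layer_bound:
  obtains C where "C \<ge> 0" "\<And>\<epsilon>. \<epsilon> > 0 \<Longrightarrow> (\<integral>x. cutoff' \<epsilon> (- \<rho> x) * (norm (grad \<rho> x))\<^sup>2 \<partial>lborel) \<le> C"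
proof
  have ci: "set_integrable lborel \<Omega> (\<lambda>x. \<bar>div_field (grad \<rho>) x\<bar>)"
    by (intro set_integrable_continuous continuous_intros C1_field_continuous_div C1_grad_rho)
  show "0 \<le> (LINT x:\<Omega>|lborel. \<bar>div_field (grad \<rho>) x\<bar>)"
    unfolding set_lebesgue_integral_def by (intro Bochner_Integration.integral_nonneg) auto
  fix \<epsilon> :: real assume eps: "\<epsilon> > 0"
  have "(\<integral>x. cutoff' \<epsilon> (- \<rho> x) * (norm (grad \<rho> x))\<^sup>2 \<partial>lborel) =
    (\<integral>x. cutoff \<epsilon> (- \<rho> x) * div_field (grad \<rho>) x \<partial>lborel)"
    using cutoff_identity[OF eps C1_const[of 1] C1_grad_rho] by (simp add: power2_norm_eq_inner)
  also have "\<dots> \<le> (LINT x:\<Omega>|lborel. \<bar>div_field (grad \<rho>) x\<bar>)"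
    unfolding set_lebesgue_integral_def
  proof (rule integral_mono)
    show "integrable lborel (\<lambda>x. cutoff \<epsilon> (- \<rho> x) * div_field (grad \<rho>) x)"
      by (rule integrable_vanish_outside)
        (use mem_iff in \<open>auto intro!: continuous_intros C1_continuous[OF C1_cutoff[OF eps]]
         C1_field_continuous_div C1_grad_rho simp: not_less\<close>)
    show "integrable lborel (\<lambda>x. indicator \<Omega> x *\<^sub>R \<bar>div_field (grad \<rho>) x\<bar>)"
      using ci by (simp add: set_integrable_def)
    fix x
    show "cutoff \<epsilon> (- \<rho> x) * div_field (grad \<rho>) x \<le> indicator \<Omega> x *\<^sub>R \<bar>div_field (grad \<rho>) x\<bar>"
    proof (cases "x \<in> \<Omega>")
      case True
      have "cutoff \<epsilon> (- \<rho> x) * div_field (grad \<rho>) x \<le> cutoff \<epsilon> (- \<rho> x) * \<bar>div_field (grad \<rho>) x\<bar>"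
        by (intro mult_left_mono cutoff_bounds) auto
      also have "\<dots> \<le> 1 * \<bar>div_field (grad \<rho>) x\<bar>" by (intro mult_right_mono cutoff_bounds) auto
      finally show ?thesis using True by simp
    qed (use mem_iff in \<open>auto simp: not_less\<close>)
  qed
  finally show "(\<integral>x. cutoff' \<epsilon> (- \<rho> x) * (norm (grad \<rho> x))\<^sup>2 \<partial>lborel) \<le> (LINT x:\<Omega>|lborel. \<bar>div_field (grad \<rho>) x\<bar>)" .
qed

text \<open>The points of the closure where \<open>\<bar>G x\<bar>\<close> is at least the first
  term form a compact set. It misses the frontier, since there \<open>G\<close> vanishes and
  \<open>grad \<rho>\<close> does not; hence \<open>\<rho>^2\<close> has a positive minimum on it,
  and \<open>K\<close> is the maximum bound of \<open>G\<close> divided by that minimum.\<close>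

lemma boundary_term_bound:
  fixes G :: "real^'n \<Rightarrow> real"
  assumes G: "continuous_on UNIV G" "\<And>x. x \<in> frontier \<Omega> \<Longrightarrow> G x = 0" and "\<kappa> > 0"
  obtains K where "K \<ge> 0" "\<And>x. x \<in> \<Omega> \<Longrightarrow> \<bar>G x\<bar> \<le> \<kappa> * (norm (grad \<rho> x))\<^sup>2 + K * (\<rho> x)\<^sup>2"
proof -
  define S where "S = {x \<in> closure \<Omega>. \<kappa> * (norm (grad \<rho> x))\<^sup>2 \<le> \<bar>G x\<bar>}"
  have cg: "continuous_on UNIV (\<lambda>x. \<kappa> * (norm (grad \<rho> x))\<^sup>2)"
    by (intro continuous_intros C1_field_continuous C1_grad_rho)
  have "closed {x. \<kappa> * (norm (grad \<rho> x))\<^sup>2 \<le> \<bar>G x\<bar>}"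
    by (intro closed_Collect_le cg continuous_intros G)
  then have "compact S"
    unfolding S_def using compact_Int_closed[OF compact_closure_domain] by (simp add: Collect_conj_eq)
  have nz: "\<rho> x \<noteq> 0" if "x \<in> S" for x
  proof
    assume "\<rho> x = 0"
    then have "x \<in> frontier \<Omega>" using that closure_cases[of x] mem_iff[of x] by (auto simp: S_def)
    then show False using G(2) grad_rho_frontier that \<open>\<kappa> > 0\<close> by (auto simp: S_def mult_le_0_iff)
  qed
  obtain M where M: "M \<ge> 0" "\<And>x. x \<in> closure \<Omega> \<Longrightarrow> norm (G x) \<le> M"
    using bounded_on_closure[OF continuous_on_subset[OF G(1) subset_UNIV]] by blast
  show ?thesis
  proof (cases "S = {}")
    case True
    show ?thesis
      by (rule that[of 0]) (use True closure_subset[of \<Omega>] in \<open>auto simp: S_def not_le intro: less_imp_le\<close>)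
  next
    case False
    have "continuous_on S (\<lambda>x. (\<rho> x)\<^sup>2)" by (intro continuous_intros C1_continuous C1_rho)
    from continuous_attains_inf[OF \<open>compact S\<close> False this]
    obtain y where y: "y \<in> S" "\<And>x. x \<in> S \<Longrightarrow> (\<rho> y)\<^sup>2 \<le> (\<rho> x)\<^sup>2" by auto
    have py: "(\<rho> y)\<^sup>2 > 0" using nz[OF y(1)] by simp
    show ?thesis
    proof (rule that[of "M / (\<rho> y)\<^sup>2"])
      show "0 \<le> M / (\<rho> y)\<^sup>2" using M by simp
      fix x assume x: "x \<in> \<Omega>"
      show "\<bar>G x\<bar> \<le> \<kappa> * (norm (grad \<rho> x))\<^sup>2 + M / (\<rho> y)\<^sup>2 * (\<rho> x)\<^sup>2"
      proof (cases "x \<in> S")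
        case True
        have "\<bar>G x\<bar> \<le> M" using M(2)[of x] x closure_subset by auto
        also have "\<dots> = M / (\<rho> y)\<^sup>2 * (\<rho> y)\<^sup>2" using py by simp
        also have "\<dots> \<le> M / (\<rho> y)\<^sup>2 * (\<rho> x)\<^sup>2" using y(2)[OF True] M(1) by (intro mult_left_mono) auto
        also have "\<dots> \<le> \<kappa> * (norm (grad \<rho> x))\<^sup>2 + M / (\<rho> y)\<^sup>2 * (\<rho> x)\<^sup>2" using \<open>\<kappa> > 0\<close> by simp
        finally show ?thesis .
      next
        case False
        then have "\<bar>G x\<bar> \<le> \<kappa> * (norm (grad \<rho> x))\<^sup>2" using x closure_subset by (force simp: S_def)
        moreover have "0 \<le> M / (\<rho> y)\<^sup>2 * (\<rho> x)\<^sup>2" using M(1) by simp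
        ultimately show ?thesis by linarith
      qed
    qed
  qed
qed

text \<open>Dominated convergence handles the left side of \<open>cutoff_identity\<close>. In the
  layer term the part with \<open>\<kappa>\<close> is controlled by
  \<open>cutoff_layer_bound\<close> and the part with \<open>\<rho>^2\<close> by
  \<open>cutoff'_mult_square\<close>. Only the product is required to vanish on the frontier, so a
  zero of the test function and a tangential field may alternate from point to point.\<close>

lemma integration_by_parts:
  assumes phi: "C1 \<phi>" and X: "C1_field X"
    and bd: "\<And>x. x \<in> frontier \<Omega> \<Longrightarrow> \<phi> x * (grad \<rho> x \<bullet> X x) = 0"
  shows "(LINT x:\<Omega>|lborel. fderiv \<phi> x (X x) + \<phi> x * div_field X x) = 0" (is "?L = 0")
proof -
  define F where "F x = fderiv \<phi> x (X x) + \<phi> x * div_field X x" for x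
  define G where "G x = \<phi> x * (grad \<rho> x \<bullet> X x)" for x
  define e where "e k = 1 / real (Suc k)" for k
  have e: "e k > 0" for k by (simp add: e_def)
  have e0: "e \<longlonglongrightarrow> 0"
    unfolding e_def using LIMSEQ_inverse_real_of_nat by (simp add: divide_inverse)
  have contG: "continuous_on UNIV G"
    unfolding G_def by (intro continuous_intros C1_continuous[OF phi]
         C1_field_continuous[OF X] C1_field_continuous[OF C1_grad_rho])
  have "fderiv \<phi> x (X x) = (\<Sum>i\<in>UNIV. fderiv \<phi> x (axis i 1) * X x $ i)" for x
    by (simp add: fderiv_grad[OF phi, of x "X x"] grad_def inner_vec_def)
  then have contF: "continuous_on UNIV F"
    unfolding F_def by (simp, intro continuous_intros C1_continuous[OF phi]
         C1_field_continuous_div[OF X] C1_continuous_fderiv[OF phi] continuous_on_component C1_field_continuous[OF X])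
  have z: "cutoff \<epsilon> (- \<rho> x) = 0" "cutoff' \<epsilon> (- \<rho> x) = 0" if "x \<notin> \<Omega>" for x \<epsilon> using that mem_iff[of x] by auto
  have siF: "set_integrable lborel \<Omega> F"
    by (intro set_integrable_continuous continuous_on_subset[OF contF]) auto
  have lim: "(\<lambda>k. \<integral>x. cutoff (e k) (- \<rho> x) * F x \<partial>lborel) \<longlonglongrightarrow> (LINT x:\<Omega>|lborel. F x)"
    unfolding set_lebesgue_integral_def
  proof (rule integral_dominated_convergence)
    show "integrable lborel (\<lambda>x. indicator \<Omega> x *\<^sub>R \<bar>F x\<bar>)"
      using set_integrable_abs[OF siF] by (simp add: set_integrable_def)
    show "(\<lambda>x. indicator \<Omega> x *\<^sub>R F x) \<in> borel_measurable lborel"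
      using siF by (auto simp: set_integrable_def)
    show "(\<lambda>x. cutoff (e k) (- \<rho> x) * F x) \<in> borel_measurable lborel" for k
      by (rule borel_measurable_integrable[OF integrable_vanish_outside])
         (use z in \<open>auto intro!: continuous_intros C1_continuous[OF C1_cutoff[OF e]] contF\<close>)
    have "(\<lambda>k. cutoff (e k) (- \<rho> x) * F x) \<longlonglongrightarrow> indicator \<Omega> x *\<^sub>R F x" for x
    proof (cases "x \<in> \<Omega>")
      case True
      then have "(\<lambda>k. cutoff (e k) (- \<rho> x) * F x) \<longlonglongrightarrow> 1 * F x"
        unfolding e_def using mem_iff by (intro tendsto_mult cutoff_tendsto) auto
      then show ?thesis using True by simp
    qed (use z in auto)
    then show "AE x in lborel. (\<lambda>k. cutoff (e k) (- \<rho> x) * F x) \<longlonglongrightarrow> indicator \<Omega> x *\<^sub>R F x" by simp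
    have "norm (cutoff (e k) (- \<rho> x) * F x) \<le> indicator \<Omega> x *\<^sub>R \<bar>F x\<bar>" for k x
      by (cases "x \<in> \<Omega>") (auto simp: z abs_mult cutoff_bounds abs_of_nonneg intro: mult_left_le_one_le)
    then show "AE x in lborel. norm (cutoff (e k) (- \<rho> x) * F x) \<le> indicator \<Omega> x *\<^sub>R \<bar>F x\<bar>" for k by simp
  qed
  obtain C where C: "C \<ge> 0" "\<And>\<epsilon>. \<epsilon> > 0 \<Longrightarrow> (\<integral>x. cutoff' \<epsilon> (- \<rho> x) * (norm (grad \<rho> x))\<^sup>2 \<partial>lborel) \<le> C"
    using cutoff_layer_bound by blast
  have G0: "G x = 0" if "x \<in> frontier \<Omega>" for x using bd[OF that] by (simp add: G_def)
  \<comment> \<open>\<open>K\<close> depends on \<open>\<kappa>\<close> and may be large, so the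
    limit in \<open>k\<close> is taken with \<open>\<kappa>\<close> fixed: the factor
    \<open>e k\<close> then removes the term with \<open>K\<close>.\<close>
  have "\<bar>LINT x:\<Omega>|lborel. F x\<bar> \<le> \<kappa> * C" if kap: "\<kappa> > 0" for \<kappa>
  proof -
    obtain K where K: "K \<ge> 0" "\<And>x. x \<in> \<Omega> \<Longrightarrow> \<bar>G x\<bar> \<le> \<kappa> * (norm (grad \<rho> x))\<^sup>2 + K * (\<rho> x)\<^sup>2"
      using boundary_term_bound[OF contG G0 kap] by blast
    have bnd: "\<bar>\<integral>x. cutoff (e k) (- \<rho> x) * F x \<partial>lborel\<bar> \<le> \<kappa> * C + K * (e k * measure lborel \<Omega>)" for k
    proof -
      let ?c = "\<lambda>x. cutoff' (e k) (- \<rho> x)"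
      have i1: "integrable lborel (\<lambda>x. ?c x * (norm (grad \<rho> x))\<^sup>2)"
        by (rule integrable_vanish_outside)
         (use z in \<open>auto intro!: continuous_intros continuous_cutoff'_rho e C1_field_continuous C1_grad_rho\<close>)
      have i2: "integrable lborel (\<lambda>x. ?c x * (\<rho> x)\<^sup>2)"
        by (rule integrable_vanish_outside)
         (use z in \<open>auto intro!: continuous_intros continuous_cutoff'_rho e C1_continuous[OF C1_rho]\<close>)
      have i3: "integrable lborel (\<lambda>x. indicator \<Omega> x :: real)"
        using set_integrable_continuous[of "\<lambda>_. 1"] by (simp add: set_integrable_def)
      have "\<bar>\<integral>x. cutoff (e k) (- \<rho> x) * F x \<partial>lborel\<bar> = \<bar>\<integral>x. ?c x * G x \<partial>lborel\<bar>"
        unfolding F_def G_def cutoff_identity[OF e phi X] ..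
      also have "\<dots> \<le> (\<integral>x. \<bar>?c x * G x\<bar> \<partial>lborel)" by (rule integral_abs_bound)
      also have "\<dots> \<le> (\<integral>x. \<kappa> * (?c x * (norm (grad \<rho> x))\<^sup>2) + K * (?c x * (\<rho> x)\<^sup>2) \<partial>lborel)"
      proof (rule integral_mono)
        show "integrable lborel (\<lambda>x. \<bar>?c x * G x\<bar>)"
          by (rule integrable_vanish_outside)
            (use z in \<open>auto intro!: continuous_intros continuous_cutoff'_rho e contG\<close>)
        show "integrable lborel (\<lambda>x. \<kappa> * (?c x * (norm (grad \<rho> x))\<^sup>2) + K * (?c x * (\<rho> x)\<^sup>2))"
          using i1 i2 by simp
        fix x
        show "\<bar>?c x * G x\<bar> \<le> \<kappa> * (?c x * (norm (grad \<rho> x))\<^sup>2) + K * (?c x * (\<rho> x)\<^sup>2)"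
        proof (cases "x \<in> \<Omega>")
          case True
          have "\<bar>?c x * G x\<bar> = ?c x * \<bar>G x\<bar>" by (simp add: abs_mult cutoff'_nonneg)
          also have "\<dots> \<le> ?c x * (\<kappa> * (norm (grad \<rho> x))\<^sup>2 + K * (\<rho> x)\<^sup>2)"
            using K(2)[OF True] by (intro mult_left_mono cutoff'_nonneg)
          finally show ?thesis by (simp add: algebra_simps)
        qed (simp add: z)
      qed
      also have "\<dots> = \<kappa> * (\<integral>x. ?c x * (norm (grad \<rho> x))\<^sup>2 \<partial>lborel) + K * (\<integral>x. ?c x * (\<rho> x)\<^sup>2 \<partial>lborel)"
        using i1 i2 by simp
      also have "(\<integral>x. ?c x * (\<rho> x)\<^sup>2 \<partial>lborel) \<le> (\<integral>x. e k * indicator \<Omega> x \<partial>lborel)"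
      proof (rule integral_mono[OF i2])
        show "?c x * (\<rho> x)\<^sup>2 \<le> e k * indicator \<Omega> x" for x
          using cutoff'_mult_square[OF e, of k "- \<rho> x"] by (cases "x \<in> \<Omega>") (auto simp: z)
      qed (use i3 in simp)
      also have "\<dots> = e k * measure lborel \<Omega>" by simp
      finally show ?thesis
        using mult_left_mono[OF C(2)[OF e, of k], of \<kappa>] mult_left_mono[of _ _ K] K(1) kap
        by (smt (verit))
    qed
    have l1: "(\<lambda>k. \<kappa> * C + K * (e k * measure lborel \<Omega>)) \<longlonglongrightarrow> \<kappa> * C + K * (0 * measure lborel \<Omega>)"
      by (intro tendsto_intros e0)
    have l2: "(\<lambda>k. \<bar>\<integral>x. cutoff (e k) (- \<rho> x) * F x \<partial>lborel\<bar>) \<longlonglongrightarrow> \<bar>LINT x:\<Omega>|lborel. F x\<bar>"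
      by (intro tendsto_intros lim)
    show ?thesis
      using LIMSEQ_le[OF l2 l1] bnd by simp
  qed
  note small = this
  have "\<bar>LINT x:\<Omega>|lborel. F x\<bar> \<le> 0"
  proof (rule field_le_epsilon)
    fix \<epsilon> :: real assume \<epsilon>: "\<epsilon> > 0"
    \<comment> \<open>Division by \<open>C + 1\<close> because \<open>C\<close> may be 0.\<close>
    have "\<bar>LINT x:\<Omega>|lborel. F x\<bar> \<le> \<epsilon> / (C + 1) * C"
      using small[of "\<epsilon> / (C + 1)"] \<epsilon> C(1) by simp
    also have "\<dots> \<le> \<epsilon>" using \<epsilon> C(1) by (simp add: divide_le_eq)
    finally show "\<bar>LINT x:\<Omega>|lborel. F x\<bar> \<le> 0 + \<epsilon>" by simp
  qed
  then show ?thesis unfolding F_def by simp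
qed

end

section \<open>Quasilinear conductivities and the energy estimate\<close>

definition flux :: "(real \<times> (real^'n) \<Rightarrow> real) \<Rightarrow> (real^'n \<Rightarrow> real) \<Rightarrow> real^'n \<Rightarrow> real^'n" where
  "flux a u x = a (u x, grad u x) *\<^sub>R grad u x"

lemma fderiv_dp:
  fixes a :: "real \<times> (real^'n) \<Rightarrow> real"
  assumes "C1 a"
  shows "fderiv a z (0, \<xi>) = dp a z \<bullet> \<xi>"
proof -
  have l: "linear (fderiv a z)" using assms by (rule fderiv_linear)
  have "(0, \<xi>) = (\<Sum>i\<in>UNIV. \<xi> $ i *\<^sub>R (0::real, axis i 1 :: real^'n))"
    using basis_expansion[of \<xi>] by (simp add: scalar_mult_eq_scaleR prod_eq_iff fst_sum snd_sum)
  then have "fderiv a z (0, \<xi>) = (\<Sum>i\<in>UNIV. \<xi> $ i * fderiv a z (0, axis i 1))"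
    using l by (simp only: linear_sum linear_cmul real_scaleR_def)
  then show ?thesis by (simp add: dp_def inner_vec_def mult.commute)
qed

text \<open>Symmetrisation is invisible in the quadratic form. What is left is the derivative of
  \<open>(a (s, p) *\<^sub>R p) \<bullet> \<xi>\<close> in \<open>p\<close> along \<xi>, which is
  how ellipticity becomes monotonicity of the flux.\<close>

lemma acoef_quadratic_form:
  "(\<Sum>i\<in>UNIV. \<Sum>j\<in>UNIV. acoef a (s, p) i j * \<xi> $ i * \<xi> $ j)
     = a (s, p) * (norm \<xi>)\<^sup>2 + (dp a (s, p) \<bullet> \<xi>) * (p \<bullet> \<xi>)"
proof -
  let ?D = "\<lambda>i. dp a (s, p) $ i * \<xi> $ i" and ?P = "\<lambda>i. p $ i * \<xi> $ i"
  have "(\<Sum>i\<in>UNIV. \<Sum>j\<in>UNIV. acoef a (s, p) i j * \<xi> $ i * \<xi> $ j)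
    = (\<Sum>i\<in>UNIV. \<Sum>j\<in>UNIV. (if i = j then a (s, p) * \<xi> $ i * \<xi> $ j else 0) + (?D i * ?P j + ?D j * ?P i) / 2)"
    unfolding acoef_def by (intro sum.cong refl) (simp add: algebra_simps add_divide_distrib)
  also have "\<dots> = (\<Sum>i\<in>UNIV. a (s, p) * (\<xi> $ i * \<xi> $ i))
      + (\<Sum>i\<in>UNIV. \<Sum>j\<in>UNIV. ?D i * ?P j) / 2 + (\<Sum>i\<in>UNIV. \<Sum>j\<in>UNIV. ?D j * ?P i) / 2"
    by (simp add: sum.distrib add_divide_distrib sum_divide_distrib mult.assoc)
  also have "(\<Sum>i\<in>UNIV. \<Sum>j\<in>UNIV. ?D j * ?P i) = (\<Sum>i\<in>UNIV. \<Sum>j\<in>UNIV. ?D i * ?P j)"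
    by (rule sum.swap)
  also have "(\<Sum>i\<in>UNIV. \<Sum>j\<in>UNIV. ?D i * ?P j) = (dp a (s, p) \<bullet> \<xi>) * (p \<bullet> \<xi>)"
    by (simp add: inner_vec_def sum_product)
  also have "(\<Sum>i\<in>UNIV. a (s, p) * (\<xi> $ i * \<xi> $ i)) = a (s, p) * (norm \<xi>)\<^sup>2"
    by (simp add: power2_norm_eq_inner inner_vec_def sum_distrib_left)
  finally show ?thesis by simp
qed

locale conductivity =
  fixes a :: "real \<times> (real^'n) \<Rightarrow> real" and lam lam0 mu0 B
  assumes admissible: "admissible lam lam0 mu0 B a"
    and lam0_pos: "\<And>t. t \<ge> 0 \<Longrightarrow> lam0 t > 0" and lam0_antimono: "antimono_on {0..} lam0"
    and mu0_mono: "mono_on {0..} mu0"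
begin

lemma smooth_a: "smooth a" and C1_a: "C1 a"
  using admissible smooth_C1 unfolding admissible_def by auto

lemma ellipticity:
  "a (s, p) * (norm \<xi>)\<^sup>2 + (dp a (s, p) \<bullet> \<xi>) * (p \<bullet> \<xi>) \<ge> lam0 \<bar>s\<bar> * (norm \<xi>)\<^sup>2"
proof (cases "\<xi> = 0")
  case False
  have "lam0 \<bar>s\<bar> * (norm \<xi>)\<^sup>2 \<le> lam (s, p) * (norm \<xi>)\<^sup>2"
    using admissible[unfolded admissible_def, THEN conjunct2, THEN conjunct2, THEN conjunct1]
    by (intro mult_right_mono) auto
  also have "\<dots> \<le> (\<Sum>i\<in>UNIV. \<Sum>j\<in>UNIV. acoef a (s, p) i j * \<xi> $ i * \<xi> $ j)"
    using conjunct2[OF admissible[unfolded admissible_def, THEN conjunct2, THEN conjunct1, rule_format, of s p]]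
      False by blast
  finally show ?thesis by (simp only: acoef_quadratic_form)
qed simp

lemma a_ge_1: "a (s, p) \<ge> 1"
  using admissible[unfolded admissible_def, THEN conjunct2, THEN conjunct2, THEN conjunct1] by blast

lemma ds_bound: "\<bar>ds a (s, p)\<bar> \<le> mu0 \<bar>s\<bar>"
proof -
  have g: "(1 + norm p) * \<bar>ds a (s, p)\<bar> \<le> mu0 \<bar>s\<bar> * norm p"
    and m: "norm p * norm (dp a (s, p)) + \<bar>a (s, p)\<bar> \<le> mu0 \<bar>s\<bar>"
    using admissible[unfolded admissible_def, THEN conjunct2, THEN conjunct2, THEN conjunct2, THEN conjunct1]
    by blast+
  have "0 \<le> norm p * norm (dp a (s, p)) + \<bar>a (s, p)\<bar>" by simp
  then have "0 \<le> mu0 \<bar>s\<bar>" using m by linarith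
  then have "mu0 \<bar>s\<bar> * norm p \<le> (1 + norm p) * mu0 \<bar>s\<bar>" by (simp add: algebra_simps)
  with g have "(1 + norm p) * \<bar>ds a (s, p)\<bar> \<le> (1 + norm p) * mu0 \<bar>s\<bar>" by linarith
  moreover have "1 + norm p > 0" using norm_ge_zero[of p] by linarith
  ultimately show ?thesis by (simp only: mult_le_cancel_left_pos)
qed

lemma lipschitz_s:
  assumes "\<bar>s1\<bar> \<le> S" "\<bar>s2\<bar> \<le> S"
  shows "\<bar>a (s1, p) - a (s2, p)\<bar> \<le> mu0 S * \<bar>s1 - s2\<bar>"
proof -
  have "norm (a (s1, p) - a (s2, p)) \<le> mu0 S * norm (s1 - s2)"
  proof (rule differentiable_bound[where S = "{-S..S}" and f' = "\<lambda>s h. fderiv a (s, p) (h, 0)"])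
    show "((\<lambda>s. a (s, p)) has_derivative (\<lambda>h. fderiv a (s, p) (h, 0))) (at s within {- S..S})" for s
    proof (rule has_derivative_compose[OF _ C1_has_derivative[OF C1_a]])
      show "((\<lambda>s. (s, p)) has_derivative (\<lambda>h. (h, 0))) (at s within {- S..S})"
        by (auto intro!: derivative_eq_intros)
    qed
    fix s assume s: "s \<in> {-S..S}"
    have "mu0 \<bar>s\<bar> \<le> mu0 S" using s by (intro mono_onD[OF mu0_mono]) auto
    moreover have "fderiv a (s, p) (h, 0) = h * ds a (s, p)" for h
      using linear_cmul[OF fderiv_linear[OF C1_a], of "(s, p)" h "(1, 0)"] by (simp add: ds_def)
    ultimately show "onorm (\<lambda>h. fderiv a (s, p) (h, 0)) \<le> mu0 S"
      using ds_bound[of s p] by (intro onorm_bound) (auto simp: abs_mult mult.commute intro!: mult_left_mono)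
  qed (use assms in auto)
  then show ?thesis by simp
qed

text \<open>The difference is split at \<open>(s1, p2)\<close>. Moving \<open>p\<close> at fixed
  \<open>s1\<close> is a mean value argument along the segment, bounded below by ellipticity; moving
  \<open>s\<close> at fixed \<open>p2\<close> costs the Lipschitz term. This is why only
  \<open>p2\<close> has to be bounded.\<close>

lemma monotonicity:
  assumes s: "\<bar>s1\<bar> \<le> S" "\<bar>s2\<bar> \<le> S" and P: "norm p2 \<le> P"
  shows "lam0 S * (norm (p1 - p2))\<^sup>2 - mu0 S * P * \<bar>s1 - s2\<bar> * norm (p1 - p2)
    \<le> (a (s1, p1) *\<^sub>R p1 - a (s2, p2) *\<^sub>R p2) \<bullet> (p1 - p2)"
proof -
  define \<xi> where "\<xi> = p1 - p2"
  define \<theta> where "\<theta> t = a (s1, p2 + t *\<^sub>R \<xi>) * ((p2 + t *\<^sub>R \<xi>) \<bullet> \<xi>)" for t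
  define \<theta>' where "\<theta>' t = a (s1, p2 + t *\<^sub>R \<xi>) * (norm \<xi>)\<^sup>2 +
     (dp a (s1, p2 + t *\<^sub>R \<xi>) \<bullet> \<xi>) * ((p2 + t *\<^sub>R \<xi>) \<bullet> \<xi>)" for t
  have "\<exists>t. 0 < t \<and> t < 1 \<and> \<theta> 1 - \<theta> 0 = (1 - 0) * \<theta>' t"
  proof (rule MVT2)
    fix t :: real
    have "((\<lambda>t. (s1, p2 + t *\<^sub>R \<xi>)) has_derivative (\<lambda>h. (0, h *\<^sub>R \<xi>))) (at t)"
      by (auto intro!: derivative_eq_intros)
    from has_derivative_compose[OF this C1_has_derivative[OF C1_a]]
    have "((\<lambda>t. a (s1, p2 + t *\<^sub>R \<xi>)) has_real_derivative dp a (s1, p2 + t *\<^sub>R \<xi>) \<bullet> \<xi>) (at t)"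
      by (simp add: fderiv_dp[OF C1_a] has_field_derivative_def mult_commute_abs)
    moreover have "((\<lambda>t. (p2 + t *\<^sub>R \<xi>) \<bullet> \<xi>) has_real_derivative \<xi> \<bullet> \<xi>) (at t)"
      unfolding has_field_derivative_def by (auto intro!: derivative_eq_intros simp: fun_eq_iff)
    ultimately show "(\<theta> has_real_derivative \<theta>' t) (at t)"
      unfolding \<theta>_def[abs_def] \<theta>'_def
      by (rule DERIV_mult[THEN DERIV_cong]) (simp add: power2_norm_eq_inner algebra_simps)
  qed simp
  then obtain t where t: "\<theta> 1 - \<theta> 0 = \<theta>' t" by auto
  have "lam0 S \<le> lam0 \<bar>s1\<bar>" using monotone_onD[OF lam0_antimono, of "\<bar>s1\<bar>" S] s by auto
  then have "lam0 S * (norm \<xi>)\<^sup>2 \<le> lam0 \<bar>s1\<bar> * (norm \<xi>)\<^sup>2" by (intro mult_right_mono) auto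
  also have "\<dots> \<le> \<theta>' t" unfolding \<theta>'_def by (rule ellipticity)
  finally have 1: "lam0 S * (norm \<xi>)\<^sup>2 \<le> \<theta> 1 - \<theta> 0" using t by simp
  have "\<bar>(a (s1, p2) - a (s2, p2)) * (p2 \<bullet> \<xi>)\<bar> \<le> (mu0 S * \<bar>s1 - s2\<bar>) * (P * norm \<xi>)"
    unfolding abs_mult
  proof (intro mult_mono lipschitz_s s)
    have "\<bar>p2 \<bullet> \<xi>\<bar> \<le> norm p2 * norm \<xi>" by (rule Cauchy_Schwarz_ineq2)
    also have "\<dots> \<le> P * norm \<xi>" using P by (intro mult_right_mono) auto
    finally show "\<bar>p2 \<bullet> \<xi>\<bar> \<le> P * norm \<xi>" .
    show "0 \<le> mu0 S * \<bar>s1 - s2\<bar>" using lipschitz_s[OF s, of 0] abs_ge_zero order_trans by blast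
  qed auto
  then have 2: "- (mu0 S * P * \<bar>s1 - s2\<bar> * norm \<xi>) \<le> (a (s1, p2) - a (s2, p2)) * (p2 \<bullet> \<xi>)"
    by (simp add: ac_simps)
  have "(a (s1, p1) *\<^sub>R p1 - a (s2, p2) *\<^sub>R p2) \<bullet> \<xi> = (\<theta> 1 - \<theta> 0) + (a (s1, p2) - a (s2, p2)) * (p2 \<bullet> \<xi>)"
    by (simp add: \<theta>_def \<xi>_def inner_diff_left algebra_simps)
  with 1 2 show ?thesis unfolding \<xi>_def by linarith
qed

lemma C1_field_flux:
  assumes "smooth u"
  shows "C1_field (flux a u)"
proof -
  have g: "C1 (\<lambda>x. grad u x $ i)" for i using smooth_C1_field_grad[OF assms] by (simp add: C1_field_def)
  have "C1 (\<lambda>x. a (u x, grad u x))"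
  proof (rule C1_comp[OF C1_a])
    fix b :: "real \<times> (real^'n)" assume "b \<in> Basis"
    then consider "b = (1, 0)" | i where "b = (0, axis i 1)"
      by (auto simp: Basis_prod_def Basis_vec_def)
    then show "C1 (\<lambda>x. (u x, grad u x) \<bullet> b)"
      by cases (auto simp: inner_axis g smooth_C1 assms)
  qed
  then show ?thesis unfolding C1_field_def flux_def by (auto intro: C1_mult g)
qed

end

locale dirichlet_problem = level_domain \<Omega> \<rho> + conductivity a lam lam0 mu0 B
  for \<Omega> :: "(real^'n) set" and \<rho> and a :: "real \<times> (real^'n) \<Rightarrow> real" and lam lam0 mu0 B
begin

text \<open>Boundary values are left out, so that one notion serves Dirichlet and Neumann
  comparisons.\<close>

definition solves :: "(real^'n \<Rightarrow> real) \<Rightarrow> bool" where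
  "solves u \<longleftrightarrow> smooth u \<and> (\<forall>x\<in>\<Omega>. div_field (flux a u) x = 0)"

text \<open>The derivative of the test function is proportional to the weight
  \<open>1 / (d^2 + \<delta>^2)\<close>. Against this weight Young's inequality leaves the error
  \<open>K^2 / (2 m) * d^2 / (d^2 + \<delta>^2)\<close>, which is at most \<open>K^2 / (2 m)\<close>
  for every \<delta>.\<close>

lemma energy_estimate:
  assumes u: "solves u" and z: "solves z"
    and bd: "\<And>x. x \<in> frontier \<Omega> \<Longrightarrow> u x = z x \<or> grad \<rho> x \<bullet> flux a u x = grad \<rho> x \<bullet> flux a z x"
  obtains C where "C \<ge> 0" "\<And>\<delta>. \<delta> > 0 \<Longrightarrow>
     (LINT x:\<Omega>|lborel. (norm (grad u x - grad z x))\<^sup>2 / ((u x - z x)\<^sup>2 + \<delta>\<^sup>2)) \<le> C"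
proof -
  have su: "smooth u" and sz: "smooth z" using u z by (auto simp: solves_def)
  define d where "d x = u x - z x" for x
  define X where "X x = flux a u x - flux a z x" for x
  have C1d: "C1 d" unfolding d_def by (intro C1_diff smooth_C1 su sz)
  have Cu: "C1 (\<lambda>x. flux a u x $ i)" "C1 (\<lambda>x. flux a z x $ i)" for i
    using C1_field_flux[OF su] C1_field_flux[OF sz] by (auto simp: C1_field_def)
  have CX: "C1_field X" unfolding C1_field_def X_def by (auto intro: C1_diff Cu)
  have divX: "div_field X x = 0" if "x \<in> \<Omega>" for x
  proof -
    have "div_field X x = div_field (flux a u) x - div_field (flux a z) x"
      unfolding div_field_def X_def by (simp add: fderiv_diff[OF Cu] sum_subtractf)
    then show ?thesis using u z that by (simp add: solves_def)
  qed
  have gd: "fderiv d x v = (grad u x - grad z x) \<bullet> v" for x v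
    unfolding d_def by (simp add: fderiv_diff smooth_C1 su sz fderiv_grad inner_diff_left)
  have cg: "continuous_on T (grad u)" "continuous_on T (grad z)" for T
    using su sz by (auto intro: C1_field_continuous smooth_C1_field_grad)
  have cX: "continuous_on T X" for T using CX by (rule C1_field_continuous)
  have cd: "continuous_on T d" for T using C1d by (rule C1_continuous)
  obtain S1 where S1: "S1 \<ge> 0" "\<And>x. x \<in> closure \<Omega> \<Longrightarrow> norm (u x) \<le> S1"
    using bounded_on_closure[OF C1_continuous[OF smooth_C1[OF su]]] by blast
  obtain S2 where S2: "S2 \<ge> 0" "\<And>x. x \<in> closure \<Omega> \<Longrightarrow> norm (z x) \<le> S2"
    using bounded_on_closure[OF C1_continuous[OF smooth_C1[OF sz]]] by blast
  obtain P where P: "P \<ge> 0" "\<And>x. x \<in> closure \<Omega> \<Longrightarrow> norm (grad z x) \<le> P"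
    using bounded_on_closure[OF cg(2)] by blast
  define S where "S = max S1 S2"
  define m where "m = lam0 S"
  define K where "K = mu0 S * P"
  have m: "m > 0" using lam0_pos[of S] S1 by (simp add: m_def S_def)
  have pt: "m * (norm (grad u x - grad z x))\<^sup>2 - K * \<bar>d x\<bar> * norm (grad u x - grad z x)
     \<le> (grad u x - grad z x) \<bullet> X x" if "x \<in> \<Omega>" for x
  proof -
    have "x \<in> closure \<Omega>" using that closure_subset by auto
    then show ?thesis
      using monotonicity[of "u x" S "z x" "grad z x" P "grad u x"] S1(2) S2(2) P(2)
      unfolding m_def K_def d_def X_def flux_def by (simp add: S_def inner_commute le_max_iff_disj)
  qed
  \<comment> \<open>The constant depends on the two solutions through the bounds \<open>S\<close>
    and \<open>P\<close>, but not on \<delta>: it is \<open>K^2 / (2 m)\<close> times the volume,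
    divided by the coefficient \<open>m / 2\<close> that survives absorption.\<close>
  show ?thesis
  proof (rule that[of "K\<^sup>2 / m\<^sup>2 * measure lborel \<Omega>"])
    show "0 \<le> K\<^sup>2 / m\<^sup>2 * measure lborel \<Omega>" by simp
    fix \<delta> :: real assume \<delta>: "\<delta> > 0"
    have pos: "(d x)\<^sup>2 + \<delta>\<^sup>2 > 0" for x using \<delta> by (simp add: add_nonneg_pos)
    \<comment> \<open>The normalising factor \<open>1 / \<delta>\<close> is omitted; it shows up as
      the factor \<open>\<delta>\<close> in front of \<open>I\<close> and is harmless because that
      integral is zero.\<close>
    define h where "h y = arctan (y / \<delta>)" for y
    have h: "(h has_real_derivative \<delta> / (y\<^sup>2 + \<delta>\<^sup>2)) (at y)" for y
    proof -
      have "y\<^sup>2 + \<delta>\<^sup>2 \<noteq> 0" using \<delta> by (simp add: add_nonneg_eq_0_iff)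
      then show ?thesis unfolding h_def[abs_def] using \<delta>
        by (auto intro!: derivative_eq_intros simp: field_simps power2_eq_square)
    qed
    have ch: "continuous_on UNIV (\<lambda>y. \<delta> / (y\<^sup>2 + \<delta>\<^sup>2))"
      by (intro continuous_intros) (use \<delta> in \<open>auto simp: add_nonneg_eq_0_iff\<close>)
    define I where "I x = ((grad u x - grad z x) \<bullet> X x) / ((d x)\<^sup>2 + \<delta>\<^sup>2)" for x
    define E where "E x = (norm (grad u x - grad z x))\<^sup>2 / ((d x)\<^sup>2 + \<delta>\<^sup>2)" for x
    have "(LINT x:\<Omega>|lborel. fderiv (\<lambda>x. h (d x)) x (X x) + h (d x) * div_field X x) = 0"
    proof (rule integration_by_parts[OF C1_comp_real[OF h ch C1d] CX])
      fix x assume "x \<in> frontier \<Omega>"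
      then show "h (d x) * (grad \<rho> x \<bullet> X x) = 0"
        \<comment> \<open>Where the values agree, \<open>arctan\<close> vanishes; where the fluxes
          agree, \<open>X\<close> has no normal component.\<close>
        using bd[of x] by (auto simp: h_def d_def X_def inner_diff_right)
    qed
    moreover have "(LINT x:\<Omega>|lborel. fderiv (\<lambda>x. h (d x)) x (X x) + h (d x) * div_field X x)
       = (LINT x:\<Omega>|lborel. \<delta> * I x)"
      using open_domain by (intro set_lebesgue_integral_cong)
        (auto simp: fderiv_comp_real[OF h C1d] gd divX I_def)
    ultimately have I0: "(LINT x:\<Omega>|lborel. I x) = 0" using \<delta> by simp
    have iI: "set_integrable lborel \<Omega> I"
      unfolding I_def by (intro set_integrable_continuous continuous_intros cg cX cd) (use pos in \<open>auto simp: less_le\<close>)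
    have iE: "set_integrable lborel \<Omega> E"
      unfolding E_def by (intro set_integrable_continuous continuous_intros cg cX cd) (use pos in \<open>auto simp: less_le\<close>)
    have i1: "set_integrable lborel \<Omega> (\<lambda>x. K\<^sup>2 / (2 * m))"
      by (intro set_integrable_continuous continuous_intros)
    have ptE: "m / 2 * E x \<le> I x + K\<^sup>2 / (2 * m)" if x: "x \<in> \<Omega>" for x
    proof -
      let ?q = "norm (grad u x - grad z x)" and ?J = "(grad u x - grad z x) \<bullet> X x"
      \<comment> \<open>Young's inequality by completing the square, spending half of the
        ellipticity constant.\<close>
      have "0 \<le> (m * ?q - K * \<bar>d x\<bar>)\<^sup>2 / (2 * m)" using m by simp
      also have "\<dots> = m / 2 * ?q\<^sup>2 - K * \<bar>d x\<bar> * ?q + K\<^sup>2 / (2 * m) * (d x)\<^sup>2"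
        using m by (simp add: power2_diff power_mult_distrib field_simps power2_eq_square)
      finally have "m / 2 * ?q\<^sup>2 \<le> ?J + K\<^sup>2 / (2 * m) * (d x)\<^sup>2" using pt[OF x] by linarith
      also have "\<dots> \<le> ?J + K\<^sup>2 / (2 * m) * ((d x)\<^sup>2 + \<delta>\<^sup>2)" using m by (intro add_left_mono mult_left_mono) auto
      finally have "m / 2 * ?q\<^sup>2 / ((d x)\<^sup>2 + \<delta>\<^sup>2) \<le> (?J + K\<^sup>2 / (2 * m) * ((d x)\<^sup>2 + \<delta>\<^sup>2)) / ((d x)\<^sup>2 + \<delta>\<^sup>2)"
        using pos[of x] by (intro divide_right_mono) auto
      then show ?thesis using pos[of x] \<delta> by (simp add: E_def I_def add_divide_distrib)
    qed
    have "m / 2 * (LINT x:\<Omega>|lborel. E x) = (LINT x:\<Omega>|lborel. m / 2 * E x)" by simp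
    also have "\<dots> \<le> (LINT x:\<Omega>|lborel. I x + K\<^sup>2 / (2 * m))"
      using iE iI i1 ptE by (intro set_integral_mono set_integral_add) auto
    also have "\<dots> = K\<^sup>2 / (2 * m) * measure lborel \<Omega>"
      using iI i1 I0 by (simp add: set_integral_add) (simp add: set_lebesgue_integral_def)
    finally have "m / 2 * (LINT x:\<Omega>|lborel. E x) \<le> K\<^sup>2 / (2 * m) * measure lborel \<Omega>" .
    then have "(LINT x:\<Omega>|lborel. E x) \<le> K\<^sup>2 / m\<^sup>2 * measure lborel \<Omega>"
      using m by (simp add: field_simps power2_eq_square)
    then show "(LINT x:\<Omega>|lborel. (norm (grad u x - grad z x))\<^sup>2 / ((u x - z x)\<^sup>2 + \<delta>\<^sup>2)) \<le> K\<^sup>2 / m\<^sup>2 * measure lborel \<Omega>"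
      by (simp add: E_def d_def)
  qed
qed

end

section \<open>Uniqueness for the Dirichlet and the Neumann problem\<close>

context dirichlet_problem
begin

text \<open>Since \<open>ln (1 + d^2 / \<delta>^2)\<close> vanishes on the frontier, integrating it
  against a field of divergence 1 is a Poincare inequality: its integral is bounded by the volume
  and the energy, uniformly in \<delta>. On a ball where \<open>d\<close> stays away from 0 the same
  function tends to infinity.\<close>

lemma dirichlet_uniqueness:
  assumes u: "solves u" and z: "solves z" and eq: "\<And>x. x \<in> frontier \<Omega> \<Longrightarrow> u x = z x"
    and x0: "x0 \<in> \<Omega>"
  shows "u x0 = z x0"
proof (rule ccontr)
  assume neq: "u x0 \<noteq> z x0"
  have su: "smooth u" and sz: "smooth z" using u z by (auto simp: solves_def)
  define d where "d x = u x - z x" for x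
  have C1d: "C1 d" unfolding d_def by (intro C1_diff smooth_C1 su sz)
  have cd: "continuous_on T d" for T using C1d by (rule C1_continuous)
  have cg: "continuous_on T (grad u)" "continuous_on T (grad z)" for T
    using su sz by (auto intro: C1_field_continuous smooth_C1_field_grad)
  have gd: "fderiv d x v = (grad u x - grad z x) \<bullet> v" for x v
    unfolding d_def by (simp add: fderiv_diff smooth_C1 su sz fderiv_grad inner_diff_left)
  obtain C where C: "C \<ge> 0" "\<And>\<delta>. \<delta> > 0 \<Longrightarrow>
     (LINT x:\<Omega>|lborel. (norm (grad u x - grad z x))\<^sup>2 / ((u x - z x)\<^sup>2 + \<delta>\<^sup>2)) \<le> C"
    using energy_estimate[OF u z] eq by blast
  \<comment> \<open>Any coordinate serves: the Poincare inequality is one-dimensional, and the field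
    \<open>x $ k\<close> times the unit vector has divergence 1.\<close>
  define k :: 'n where "k = undefined"
  define X :: "real^'n \<Rightarrow> real^'n" where "X x = (x $ k) *\<^sub>R axis k 1" for x
  have Xi: "X x $ i = (if i = k then axis k 1 \<bullet> x else 0)" for x i
    by (cases "i = k") (simp_all add: X_def inner_axis', simp add: axis_def)
  have "C1 (\<lambda>x. X x $ i)" for i by (cases "i = k") (simp_all add: Xi C1_inner C1_const)
  then have CX: "C1_field X" by (simp add: C1_field_def)
  have divX: "div_field X x = 1" for x
  proof -
    have "fderiv (\<lambda>y. X y $ i) x (axis i 1) = (if i = k then 1 else 0)" for i
      by (cases "i = k") (simp_all add: Xi fderiv_inner inner_axis_axis)
    then show ?thesis unfolding div_field_def by simp
  qed
  obtain R where R: "R \<ge> 0" "\<And>x. x \<in> closure \<Omega> \<Longrightarrow> norm x \<le> R"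
    using bounded_on_closure[OF continuous_on_id] by blast
  define m where "m = \<bar>d x0\<bar> / 2"
  have m: "m > 0" using neq by (simp add: m_def d_def)
  have "open (\<Omega> \<inter> {x. m < \<bar>d x\<bar>})"
    using open_Collect_less[of "\<lambda>_. m" "\<lambda>x. \<bar>d x\<bar>"] cd open_domain by (auto intro!: continuous_intros)
  moreover have "x0 \<in> \<Omega> \<inter> {x. m < \<bar>d x\<bar>}" using x0 m by (simp add: m_def)
  ultimately obtain r where r: "r > 0" "ball x0 r \<subseteq> \<Omega> \<inter> {x. m < \<bar>d x\<bar>}"
    using openE by blast
  define b where "b = measure lborel (ball x0 r)"
  have b: "b > 0" using content_ball_pos[OF r(1)] by (simp add: b_def)
  have i1: "set_integrable lborel \<Omega> (\<lambda>x. 1::real)"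
    by (intro set_integrable_continuous continuous_intros)
  have bound: "b * ln (1 + m\<^sup>2 / \<delta>\<^sup>2) \<le> R * (measure lborel \<Omega> + C)" if \<delta>: "\<delta> > 0" for \<delta>
  proof -
    have pos: "y\<^sup>2 + \<delta>\<^sup>2 > 0" for y using \<delta> by (simp add: add_nonneg_pos)
    define h where "h y = ln (1 + y\<^sup>2 / \<delta>\<^sup>2)" for y
    have h: "(h has_real_derivative 2 * y / (y\<^sup>2 + \<delta>\<^sup>2)) (at y)" for y
    proof -
      have "1 + y\<^sup>2 / \<delta>\<^sup>2 > 0" by (simp add: add_pos_nonneg)
      then have "(h has_real_derivative (2 * y / \<delta>\<^sup>2) / (1 + y\<^sup>2 / \<delta>\<^sup>2)) (at y)"
      proof -
        have i: "((\<lambda>y. 1 + y\<^sup>2 / \<delta>\<^sup>2) has_real_derivative 2 * y / \<delta>\<^sup>2) (at y)"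
        proof -
          have "((\<lambda>y. y\<^sup>2) has_real_derivative 2 * y) (at y)" by (auto intro!: derivative_eq_intros)
          from DERIV_add[OF DERIV_const[of 1] DERIV_cdivide[OF this, of "\<delta>\<^sup>2"]] show ?thesis by simp
        qed
        show ?thesis
          using DERIV_chain2[OF DERIV_ln[OF \<open>1 + y\<^sup>2 / \<delta>\<^sup>2 > 0\<close>] i] by (simp add: h_def[abs_def] field_simps)
      qed
      moreover have "(2 * y / \<delta>\<^sup>2) / (1 + y\<^sup>2 / \<delta>\<^sup>2) = 2 * y / (y\<^sup>2 + \<delta>\<^sup>2)"
      proof -
        have "1 + y\<^sup>2 / \<delta>\<^sup>2 = (y\<^sup>2 + \<delta>\<^sup>2) / \<delta>\<^sup>2" using \<delta> by (simp add: field_simps)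
        then show ?thesis using \<delta> by simp
      qed
      ultimately show ?thesis by (simp only:)
    qed
    have ch: "continuous_on UNIV (\<lambda>y. 2 * y / (y\<^sup>2 + \<delta>\<^sup>2))"
      by (intro continuous_intros) (use pos in \<open>auto simp: less_le\<close>)
    define E where "E x = (norm (grad u x - grad z x))\<^sup>2 / ((d x)\<^sup>2 + \<delta>\<^sup>2)" for x
    define J where "J x = fderiv (\<lambda>x. h (d x)) x (X x)" for x
    have J: "J x = 2 * d x / ((d x)\<^sup>2 + \<delta>\<^sup>2) * ((grad u x - grad z x) \<bullet> X x)" for x
      unfolding J_def by (simp add: fderiv_comp_real[OF h C1d] gd)
    have ptJ: "- J x \<le> R * (1 + E x)" if x: "x \<in> \<Omega>" for x
    proof -
      let ?q = "norm (grad u x - grad z x)"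
      have "x \<in> closure \<Omega>" using x closure_subset by auto
      then have "norm (X x) \<le> R" using R(2)[of x] component_le_norm_cart[of x k] by (simp add: X_def)
      then have "\<bar>(grad u x - grad z x) \<bullet> X x\<bar> \<le> ?q * R"
        by (meson Cauchy_Schwarz_ineq2 mult_left_mono norm_ge_zero order_trans)
      then have "\<bar>J x\<bar> \<le> 2 * \<bar>d x\<bar> / ((d x)\<^sup>2 + \<delta>\<^sup>2) * (?q * R)"
        unfolding J abs_mult using pos[of "d x"] by (intro mult_mono) auto
      also have "\<dots> = R * (2 * \<bar>d x\<bar> * ?q / ((d x)\<^sup>2 + \<delta>\<^sup>2))" by simp
      also have "\<dots> \<le> R * (((d x)\<^sup>2 + \<delta>\<^sup>2 + ?q\<^sup>2) / ((d x)\<^sup>2 + \<delta>\<^sup>2))"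
      proof (intro mult_left_mono divide_right_mono R(1))
        \<comment> \<open>This turns the first power of the gradient into the quadratic energy at
          the price of the constant 1.\<close>
        show "2 * \<bar>d x\<bar> * ?q \<le> (d x)\<^sup>2 + \<delta>\<^sup>2 + ?q\<^sup>2"
          using sum_squares_bound[of "\<bar>d x\<bar>" ?q] zero_le_power2[of \<delta>] unfolding power2_abs by linarith
      qed (use pos[of "d x"] in auto)
      also have "\<dots> = R * (1 + E x)" using pos[of "d x"] \<delta> by (simp add: E_def add_divide_distrib)
      finally show ?thesis by linarith
    qed
    have iE: "set_integrable lborel \<Omega> E"
      unfolding E_def by (intro set_integrable_continuous continuous_intros cg cd) (use pos in \<open>auto simp: less_le\<close>)
    have iJ: "set_integrable lborel \<Omega> J"
      unfolding J[abs_def] by (intro set_integrable_continuous continuous_intros cg cd C1_field_continuous[OF CX])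
         (use pos in \<open>auto simp: less_le\<close>)
    have ihd: "set_integrable lborel \<Omega> (\<lambda>x. h (d x))"
      by (intro set_integrable_continuous C1_continuous C1_comp_real[OF h ch C1d])
    have hn: "0 \<le> h y" for y by (simp add: h_def)
    have "(LINT x:\<Omega>|lborel. J x + h (d x) * div_field X x) = 0"
      unfolding J_def
    proof (rule integration_by_parts[OF C1_comp_real[OF h ch C1d] CX])
      fix x assume "x \<in> frontier \<Omega>"
      then show "h (d x) * (grad \<rho> x \<bullet> X x) = 0"
        using eq[of x] by (auto simp: h_def d_def)
    qed
    then have "(LINT x:\<Omega>|lborel. h (d x)) = (LINT x:\<Omega>|lborel. - J x)"
      using iJ ihd by (simp add: divX set_integral_add set_integral_uminus)
    also have "\<dots> \<le> (LINT x:\<Omega>|lborel. R * (1 + E x))"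
    proof (intro set_integral_mono set_integral_add set_integrable_mult_right iE i1 ptJ)
      show "set_integrable lborel \<Omega> (\<lambda>x. - J x)" using iJ by (simp add: set_integrable_def)
    qed
    also have "\<dots> = R * (measure lborel \<Omega> + (LINT x:\<Omega>|lborel. E x))"
      using iE i1 by (simp add: set_integral_add) (simp add: set_lebesgue_integral_def)
    also have "\<dots> \<le> R * (measure lborel \<Omega> + C)"
      using C(2)[OF \<delta>] R(1) by (intro mult_left_mono) (auto simp: E_def d_def)
    finally have up: "(LINT x:\<Omega>|lborel. h (d x)) \<le> R * (measure lborel \<Omega> + C)" .
    have ihb: "set_integrable lborel (ball x0 r) (\<lambda>x. h (d x))"
      by (rule set_integrable_subset[OF ihd]) (use r(2) in auto)
    have "b * h m = (LINT x:ball x0 r|lborel. h m)"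
      by (simp add: set_lebesgue_integral_def b_def)
    also have "\<dots> \<le> (LINT x:ball x0 r|lborel. h (d x))"
    proof (rule set_integral_mono)
      show "set_integrable lborel (ball x0 r) (\<lambda>x. h m)"
        by (rule set_integrable_subset[OF set_integrable_continuous[OF continuous_on_const]]) (use r(2) in auto)
      show "set_integrable lborel (ball x0 r) (\<lambda>x. h (d x))" by (rule ihb)
      fix x assume "x \<in> ball x0 r"
      then have "m\<^sup>2 \<le> (d x)\<^sup>2" using r(2) m by (subst abs_le_square_iff[symmetric]) auto
      then show "h m \<le> h (d x)" unfolding h_def by (simp add: add_pos_nonneg divide_right_mono)
    qed
    also have "\<dots> \<le> (LINT x:\<Omega>|lborel. h (d x))"
      unfolding set_lebesgue_integral_def
    proof (rule integral_mono)
      show "integrable lborel (\<lambda>x. indicator (ball x0 r) x *\<^sub>R h (d x))"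
        using ihb by (simp add: set_integrable_def)
      show "integrable lborel (\<lambda>x. indicator \<Omega> x *\<^sub>R h (d x))"
        using ihd by (simp add: set_integrable_def)
      show "indicator (ball x0 r) x *\<^sub>R h (d x) \<le> indicator \<Omega> x *\<^sub>R h (d x)" for x
        using r(2) hn by (auto split: split_indicator)
    qed
    finally show ?thesis using up by (simp add: h_def)
  qed
  \<comment> \<open>The choice of \<delta> gives \<open>m^2 / \<delta>^2 = exp L\<close>. Then
    \<open>b * ln (1 + exp L)\<close> exceeds \<open>b * L\<close>, which is exactly the upper
    bound.\<close>
  define L where "L = R * (measure lborel \<Omega> + C) / b"
  define \<delta> where "\<delta> = m / sqrt (exp L)"
  have "\<delta> > 0" using m by (simp add: \<delta>_def)
  from bound[OF this] have "b * ln (1 + exp L) \<le> R * (measure lborel \<Omega> + C)"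
    using m by (simp add: \<delta>_def power_divide)
  then have "ln (1 + exp L) \<le> L" using b by (simp add: L_def field_simps)
  moreover have "ln (exp L) < ln (1 + exp L)" by (subst ln_less_cancel_iff) (auto simp: add_pos_pos)
  ultimately show False by simp
qed

text \<open>Neumann data provide no place where \<open>d\<close> is known to vanish, so averages
  over two translates of one small box are compared instead. \<open>arsinh\<close> is odd, so
  opposite signs at the two ends add up to a difference of at least
  \<open>2 * V * arsinh (m / \<delta>)\<close>; its gradient is at most 1 plus the energy density,
  which bounds the change along the segment. A difference of constant sign gives no contradiction
  here.\<close>

lemma no_sign_change:
  assumes u: "solves u" and z: "solves z"
    and bd: "\<And>x. x \<in> frontier \<Omega> \<Longrightarrow> grad \<rho> x \<bullet> flux a u x = grad \<rho> x \<bullet> flux a z x"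
    and ball: "ball x0 r \<subseteq> \<Omega>" and x1: "x1 \<in> ball x0 r" "u x1 > z x1" and x2: "x2 \<in> ball x0 r" "u x2 < z x2"
  shows False
proof -
  have su: "smooth u" and sz: "smooth z" using u z by (auto simp: solves_def)
  define d where "d x = u x - z x" for x
  have C1d: "C1 d" unfolding d_def by (intro C1_diff smooth_C1 su sz)
  have cd: "continuous_on T d" for T using C1d by (rule C1_continuous)
  have cg: "continuous_on T (grad u)" "continuous_on T (grad z)" for T
    using su sz by (auto intro: C1_field_continuous smooth_C1_field_grad)
  have gd: "fderiv d x v = (grad u x - grad z x) \<bullet> v" for x v
    unfolding d_def by (simp add: fderiv_diff smooth_C1 su sz fderiv_grad inner_diff_left)
  obtain C where C: "C \<ge> 0" "\<And>\<delta>. \<delta> > 0 \<Longrightarrow>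
     (LINT x:\<Omega>|lborel. (norm (grad u x - grad z x))\<^sup>2 / ((u x - z x)\<^sup>2 + \<delta>\<^sup>2)) \<le> C"
    using energy_estimate[OF u z] bd by blast
  define m where "m = min (d x1) (- d x2) / 2"
  have m: "m > 0" using x1 x2 by (simp add: m_def d_def)
  have "open (ball x0 r \<inter> {x. m < d x})" "open (ball x0 r \<inter> {x. d x < - m})"
    using open_Collect_less[of "\<lambda>_. m" d] open_Collect_less[of d "\<lambda>_. - m"] cd by auto
  moreover have "m \<le> d x1 / 2" "m \<le> - d x2 / 2" by (simp_all add: m_def)
  then have "m < d x1" "d x2 < - m" using x1 x2 m by (simp_all add: d_def)
  then have "x1 \<in> ball x0 r \<inter> {x. m < d x}" "x2 \<in> ball x0 r \<inter> {x. d x < - m}"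
    using x1 x2 by auto
  ultimately obtain r1 r2 where r1: "r1 > 0" "ball x1 r1 \<subseteq> ball x0 r \<inter> {x. m < d x}"
    and r2: "r2 > 0" "ball x2 r2 \<subseteq> ball x0 r \<inter> {x. d x < - m}"
    by (meson openE)
  have "(0::real^'n) \<in> ball 0 (min r1 r2)" using r1(1) r2(1) by simp
  \<comment> \<open>One box of displacements for both ends, small enough that \<open>d\<close> keeps
    its sign and size on each translate.\<close>
  then obtain \<alpha> \<beta> :: "real^'n" where box: "cbox \<alpha> \<beta> \<subseteq> ball 0 (min r1 r2)" "0 \<in> box \<alpha> \<beta>"
     "\<forall>i\<in>Basis. \<alpha> \<bullet> i < \<beta> \<bullet> i"
    by (rule open_contains_cbox[OF open_ball])
  let ?Q = "cbox \<alpha> \<beta>"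
  have in1: "x1 + v \<in> ball x0 r" "m < d (x1 + v)" if "v \<in> ?Q" for v
  proof -
    have "x1 + v \<in> ball x1 r1" using that box(1) by (auto simp: dist_norm)
    then show "x1 + v \<in> ball x0 r" "m < d (x1 + v)" using r1(2) by auto
  qed
  have in2: "x2 + v \<in> ball x0 r" "d (x2 + v) < - m" if "v \<in> ?Q" for v
  proof -
    have "x2 + v \<in> ball x2 r2" using that box(1) by (auto simp: dist_norm)
    then show "x2 + v \<in> ball x0 r" "d (x2 + v) < - m" using r2(2) by auto
  qed
  define e where "e = x2 - x1"
  \<comment> \<open>Convexity of the ball keeps the moving box inside the domain; this is why both
    points are taken in one ball.\<close>
  have inseg: "x1 + t *\<^sub>R e + v \<in> \<Omega>" if "v \<in> ?Q" "t \<in> {0..1}" for v t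
  proof -
    have "x1 + t *\<^sub>R e + v = (1 - t) *\<^sub>R (x1 + v) + t *\<^sub>R (x2 + v)"
      by (simp add: e_def algebra_simps)
    also have "\<dots> \<in> ball x0 r"
      using that in1(1)[OF that(1)] in2(1)[OF that(1)] by (intro convexD[OF convex_ball]) auto
    finally show ?thesis using ball by auto
  qed
  define V where "V = measure lborel ?Q"
  have V: "V > 0"
  proof -
    have "box \<alpha> \<beta> \<noteq> {}" using box(2) by auto
    then show ?thesis unfolding V_def using content_pos_lt_eq[of \<alpha> \<beta>] by (simp add: box_ne_empty)
  qed
  have bound: "2 * V * arsinh (m / \<delta>) \<le> norm e * (measure lborel \<Omega> + C)" if \<delta>: "\<delta> > 0" for \<delta>
  proof -
    have pos: "y\<^sup>2 + \<delta>\<^sup>2 > 0" for y using \<delta> by (simp add: add_nonneg_pos)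
    define h where "h y = arsinh (y / \<delta>)" for y
    define h' where "h' y = 1 / sqrt (y\<^sup>2 + \<delta>\<^sup>2)" for y
    have h: "(h has_real_derivative h' y) (at y)" for y
    proof -
      have "(h has_real_derivative (1 / sqrt ((y / \<delta>)\<^sup>2 + 1)) * (1 / \<delta>)) (at y)"
        unfolding h_def[abs_def]
        by (rule DERIV_chain2[OF arsinh_real_has_field_derivative DERIV_cdivide[OF DERIV_ident]])
      moreover have "sqrt ((y / \<delta>)\<^sup>2 + 1) = sqrt (y\<^sup>2 + \<delta>\<^sup>2) / \<delta>"
      proof -
        have "(y / \<delta>)\<^sup>2 + 1 = (y\<^sup>2 + \<delta>\<^sup>2) / \<delta>\<^sup>2" using \<delta> by (simp add: field_simps)
        then show ?thesis using \<delta> by (simp add: real_sqrt_divide)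
      qed
      ultimately show ?thesis using \<delta> by (simp add: h'_def)
    qed
    have ch: "continuous_on UNIV h'"
      unfolding h'_def[abs_def] by (intro continuous_intros) (use pos in \<open>auto simp: less_le\<close>)
    define E where "E x = (norm (grad u x - grad z x))\<^sup>2 / ((d x)\<^sup>2 + \<delta>\<^sup>2)" for x
    have iE: "set_integrable lborel \<Omega> E"
      unfolding E_def by (intro set_integrable_continuous continuous_intros cg cd) (use pos in \<open>auto simp: less_le\<close>)
    have i1: "set_integrable lborel \<Omega> (\<lambda>x. 1::real)"
      by (intro set_integrable_continuous continuous_intros)
    have E0: "0 \<le> E x" for x using pos[of "d x"] by (simp add: E_def)
    define \<psi> where "\<psi> x = h (d x)" for x
    have C1psi: "C1 \<psi>" unfolding \<psi>_def by (rule C1_comp_real[OF h ch C1d])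
    have cpsi: "continuous_on T \<psi>" for T by (rule C1_continuous[OF C1psi])
    define D where "D x = fderiv \<psi> x e" for x
    have cD: "continuous_on T D" for T unfolding D_def by (rule C1_continuous_fderiv[OF C1psi])
    have ptD: "\<bar>D x\<bar> \<le> norm e * (1 + E x)" for x
    proof -
      let ?q = "norm (grad u x - grad z x)" and ?s = "sqrt ((d x)\<^sup>2 + \<delta>\<^sup>2)"
      have s: "?s > 0" using pos by simp
      have "D x = ((grad u x - grad z x) \<bullet> e) / ?s"
        unfolding D_def \<psi>_def by (simp add: fderiv_comp_real[OF h C1d] gd h'_def)
      then have "\<bar>D x\<bar> \<le> (?q * norm e) / ?s"
        using s Cauchy_Schwarz_ineq2[of "grad u x - grad z x" e] by (simp add: abs_divide divide_right_mono)
      also have "\<dots> = norm e * (?q / ?s)" by simp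
      also have "\<dots> \<le> norm e * (1 + (?q / ?s)\<^sup>2)"
      proof (rule mult_left_mono)
        have "0 \<le> (?q / ?s - 1)\<^sup>2" "0 \<le> (?q / ?s)\<^sup>2" by (rule zero_le_power2)+
        moreover have "(?q / ?s - 1)\<^sup>2 = (?q / ?s)\<^sup>2 - 2 * (?q / ?s) + 1" by (simp add: power2_diff)
        ultimately show "?q / ?s \<le> 1 + (?q / ?s)\<^sup>2" by linarith
      qed simp
      also have "(?q / ?s)\<^sup>2 = E x" using pos[of "d x"] by (simp add: E_def power_divide)
      finally show ?thesis .
    qed
    \<comment> \<open>The integral over the box carried from \<open>x1\<close> to \<open>x2\<close>.
      By the mean value theorem a single position \<open>t\<close> of the box accounts for the whole
      change, so no integration over the segment is involved.\<close>
    define I where "I t = integral ?Q (\<lambda>v. \<psi> (x1 + t *\<^sub>R e + v))" for t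
    define I' where "I' t = integral ?Q (\<lambda>v. D (x1 + t *\<^sub>R e + v))" for t
    have "(I has_field_derivative I' t) (at t)" for t
      unfolding I_def[abs_def] I'_def
    proof (rule leibniz_rule_field_derivative[where U = UNIV])
      fix t v
      have "((\<lambda>t. x1 + t *\<^sub>R e + v) has_derivative (\<lambda>t. t *\<^sub>R e)) (at t)"
        by (auto intro!: derivative_eq_intros)
      from has_derivative_compose[OF this C1_has_derivative[OF C1psi]]
      show "((\<lambda>t. \<psi> (x1 + t *\<^sub>R e + v)) has_field_derivative D (x1 + t *\<^sub>R e + v)) (at t)"
        using fderiv_linear[OF C1psi] by (simp add: has_field_derivative_def linear_cmul D_def mult_commute_abs)
      show "(\<lambda>v. \<psi> (x1 + t *\<^sub>R e + v)) integrable_on ?Q"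
        by (intro integrable_continuous continuous_on_compose2[OF cpsi[of UNIV]] continuous_intros) auto
      show "continuous_on (UNIV \<times> ?Q) (\<lambda>(t, v). D (x1 + t *\<^sub>R e + v))"
        unfolding split_beta by (intro continuous_on_compose2[OF cD[of UNIV]] continuous_intros) auto
    qed auto
    then have "\<exists>t. 0 < t \<and> t < 1 \<and> I 1 - I 0 = (1 - 0) * I' t" by (intro MVT2) auto
    then obtain t where t: "0 < t" "t < 1" "I 1 - I 0 = I' t" by auto
    have iQ: "set_integrable lborel ?Q (\<lambda>v. f (y + v))" if "continuous_on UNIV f" for f :: "real^'n \<Rightarrow> real" and y
      unfolding set_integrable_def
      by (intro borel_integrable_compact continuous_on_compose2[OF that] continuous_intros) auto
    have HK: "integral ?Q (\<lambda>v. f (y + v)) = (LINT v:?Q|lborel. f (y + v))" if "continuous_on UNIV f" for f :: "real^'n \<Rightarrow> real" and y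
      using set_borel_integral_eq_integral(2)[OF iQ[OF that]] by simp
    have iV: "set_integrable lborel ?Q (\<lambda>v. c)" for c :: real
      using iQ[of "\<lambda>_. c"] by simp
    have LV: "(LINT v:?Q|lborel. c) = V * c" for c :: real
      by (simp add: set_lebesgue_integral_def V_def)
    have I0: "V * arsinh (m / \<delta>) \<le> I 0"
    proof -
      have "V * arsinh (m / \<delta>) = (LINT v:?Q|lborel. arsinh (m / \<delta>))" by (simp add: LV)
      also have "\<dots> \<le> (LINT v:?Q|lborel. \<psi> (x1 + v))"
      proof (rule set_integral_mono[OF iV iQ[OF cpsi]])
        show "arsinh (m / \<delta>) \<le> \<psi> (x1 + v)" if "v \<in> ?Q" for v
          using in1(2)[OF that] \<delta> by (intro less_imp_le) (simp add: \<psi>_def h_def divide_strict_right_mono)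
      qed
      also have "\<dots> = I 0" by (simp add: I_def HK[OF cpsi])
      finally show ?thesis .
    qed
    have I1: "I 1 \<le> - (V * arsinh (m / \<delta>))"
    proof -
      have "I 1 = (LINT v:?Q|lborel. \<psi> (x2 + v))" by (simp add: I_def e_def HK[OF cpsi])
      also have "\<dots> \<le> (LINT v:?Q|lborel. arsinh (- (m / \<delta>)))"
      proof (rule set_integral_mono[OF iQ[OF cpsi] iV])
        show "\<psi> (x2 + v) \<le> arsinh (- (m / \<delta>))" if "v \<in> ?Q" for v
        proof -
          have "d (x2 + v) / \<delta> < - m / \<delta>" using in2(2)[OF that] \<delta> by (rule divide_strict_right_mono)
          then have "arsinh (d (x2 + v) / \<delta>) < arsinh (- (m / \<delta>))"
            by (subst arsinh_less_iff_real) simp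
          then show ?thesis by (simp add: \<psi>_def h_def)
        qed
      qed
      also have "\<dots> = - (V * arsinh (m / \<delta>))" by (simp add: LV)
      finally show ?thesis .
    qed
    have iN: "set_integrable lborel \<Omega> (\<lambda>x. norm e * (1 + E x))"
      by (intro set_integrable_mult_right set_integral_add iE i1)
    have mN: "(\<lambda>v. indicator \<Omega> v * (norm e * (1 + E v))) \<in> borel_measurable borel"
      using borel_measurable_integrable[OF iN[unfolded set_integrable_def]] by simp
    let ?y = "x1 + t *\<^sub>R e"
    have "\<bar>I' t\<bar> \<le> (LINT v:?Q|lborel. \<bar>D (?y + v)\<bar>)"
      unfolding I'_def HK[OF cD] set_lebesgue_integral_def
      by (rule order_trans[OF integral_abs_bound]) (simp add: abs_mult)
    \<comment> \<open>The translated box lies in the domain, so the energy over the whole domain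
      dominates.\<close>
    also have "\<dots> \<le> (\<integral>v. indicator \<Omega> (v + ?y) * (norm e * (1 + E (v + ?y))) \<partial>lborel)"
      unfolding set_lebesgue_integral_def
    proof (rule integral_mono)
      have "integrable lborel (\<lambda>v. indicator ?Q v *\<^sub>R \<bar>D (?y + v)\<bar>)"
        using iQ[of "\<lambda>x. \<bar>D x\<bar>" ?y] cD[of UNIV] by (auto simp: set_integrable_def intro: continuous_intros)
      then show "integrable lborel (\<lambda>v. indicator ?Q v *\<^sub>R \<bar>D (?y + v)\<bar>)" .
      have "integrable lborel (\<lambda>x. indicator \<Omega> x * (norm e * (1 + E x)))"
        using iN by (simp add: set_integrable_def)
      then have "integrable (distr lborel borel ((+) ?y)) (\<lambda>x. indicator \<Omega> x * (norm e * (1 + E x)))"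
        by (simp add: lborel_distr_plus)
      then show "integrable lborel (\<lambda>v. indicator \<Omega> (v + ?y) * (norm e * (1 + E (v + ?y))))"
        by (subst (asm) integrable_distr_eq) (use mN in \<open>auto simp: add.commute\<close>)
      fix v
      show "indicator ?Q v *\<^sub>R \<bar>D (?y + v)\<bar> \<le> indicator \<Omega> (v + ?y) * (norm e * (1 + E (v + ?y)))"
        using inseg[of v t] t ptD[of "?y + v"] E0[of "v + ?y"]
        by (cases "v \<in> ?Q") (auto simp: add.commute split: split_indicator)
    qed
    also have "\<dots> = (\<integral>v. indicator \<Omega> v * (norm e * (1 + E v)) \<partial>lborel)"
      by (rule integral_lborel_translate[OF mN])
    also have "\<dots> = (LINT v:\<Omega>|lborel. norm e * (1 + E v))"
      unfolding set_lebesgue_integral_def real_scaleR_def ..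
    also have "\<dots> = norm e * (measure lborel \<Omega> + (LINT x:\<Omega>|lborel. E x))"
      using iE i1 by (simp add: set_integral_add) (simp add: set_lebesgue_integral_def)
    also have "\<dots> \<le> norm e * (measure lborel \<Omega> + C)"
      using C(2)[OF \<delta>] by (intro mult_left_mono) (auto simp: E_def d_def)
    finally show ?thesis using t(3) I0 I1 by linarith
  qed
  \<comment> \<open>With \<open>\<delta> = m / sinh L\<close> the value
    \<open>arsinh (m / \<delta>)\<close> is \<open>L\<close>. The summand 1 puts \<open>L\<close>
    strictly above the bound and makes it positive.\<close>
  define L where "L = norm e * (measure lborel \<Omega> + C) / (2 * V) + 1"
  have "L > 0" using V C(1) by (simp add: L_def add_nonneg_pos)
  then have s: "sinh L > 0" by simp
  then have "m / sinh L > 0" using m by simp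
  from bound[OF this] have "2 * V * L \<le> norm e * (measure lborel \<Omega> + C)"
    using m s by (simp add: arsinh_sinh_real)
  then have "L \<le> L - 1" using V by (simp add: L_def field_simps)
  then show False by simp
qed

text \<open>The comparison function is slid through a strictly monotone family of solutions with the
  same boundary flux: this turns a mere contact point into a sign change.\<close>

lemma neumann_uniqueness:
  assumes conn: "connected \<Omega>" and u: "solves u" and Z: "\<And>\<tau>. solves (Z \<tau>)"
    and bd: "\<And>\<tau> x. x \<in> frontier \<Omega> \<Longrightarrow> grad \<rho> x \<bullet> flux a u x = grad \<rho> x \<bullet> flux a (Z \<tau>) x"
    and mono: "\<And>x. strict_mono (\<lambda>\<tau>::real. Z \<tau> x)" and cont: "\<And>x. isCont (\<lambda>\<tau>. Z \<tau> x) 0"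
    and x0: "x0 \<in> \<Omega>" "u x0 = Z 0 x0" and y: "y \<in> \<Omega>"
  shows "u y = Z 0 y"
proof -
  define S where "S = {x \<in> \<Omega>. u x = Z 0 x}"
  have su: "smooth u" and sz: "smooth (Z 0)" using u Z by (auto simp: solves_def)
  have "openin (top_of_set \<Omega>) S"
    unfolding openin_contains_ball
  proof (intro conjI ballI)
    show "S \<subseteq> \<Omega>" by (auto simp: S_def)
    fix x assume x: "x \<in> S"
    then have "x \<in> \<Omega>" by (simp add: S_def)
    with open_domain obtain r where r: "r > 0" "ball x r \<subseteq> \<Omega>" by (meson openE)
    have "u w = Z 0 w" if w: "w \<in> ball x r" for w
    proof (rule ccontr)
      assume "u w \<noteq> Z 0 w"
      then consider "Z 0 w < u w" | "u w < Z 0 w" by linarith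
      then show False
      proof cases
        case 1
        have "eventually (\<lambda>\<tau>. Z \<tau> w < u w) (at 0)"
          using cont[of w] 1 unfolding isCont_def by (rule order_tendstoD(2))
        then have "eventually (\<lambda>\<tau>. Z \<tau> w < u w) (at_right 0)" by (simp add: eventually_at_split)
        then obtain b where b: "b > 0" "\<And>\<tau>. 0 < \<tau> \<Longrightarrow> \<tau> < b \<Longrightarrow> Z \<tau> w < u w"
          unfolding eventually_at_right_field by auto
        have "Z 0 x < Z (b / 2) x" using b(1) by (intro strict_monoD[OF mono]) auto
        then have "u x < Z (b / 2) x" using x by (simp add: S_def)
        moreover have "Z (b / 2) w < u w" using b by auto
        ultimately show False
          by (intro no_sign_change[OF u Z[of "b / 2"] bd r(2) w _ centre_in_ball[THEN iffD2, OF r(1)]])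
      next
        case 2
        have "eventually (\<lambda>\<tau>. u w < Z \<tau> w) (at 0)"
          using cont[of w] 2 unfolding isCont_def by (rule order_tendstoD(1))
        then have "eventually (\<lambda>\<tau>. u w < Z \<tau> w) (at_left 0)" by (simp add: eventually_at_split)
        then obtain b where b: "b < 0" "\<And>\<tau>. b < \<tau> \<Longrightarrow> \<tau> < 0 \<Longrightarrow> u w < Z \<tau> w"
          unfolding eventually_at_left_field by auto
        have "Z (b / 2) x < Z 0 x" using b(1) by (intro strict_monoD[OF mono]) auto
        then have "Z (b / 2) x < u x" using x by (simp add: S_def)
        moreover have "u w < Z (b / 2) w" using b by auto
        ultimately show False
          by (intro no_sign_change[OF u Z[of "b / 2"] bd r(2) centre_in_ball[THEN iffD2, OF r(1)] _ w])
      qed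
    qed
    then show "\<exists>e>0. ball x e \<inter> \<Omega> \<subseteq> S"
      using r by (intro exI[of _ r]) (auto simp: S_def)
  qed
  moreover have "closedin (top_of_set \<Omega>) S"
  proof -
    have "closed {x. u x = Z 0 x}"
      by (intro closed_Collect_eq C1_continuous smooth_C1 su sz)
    moreover have "S = \<Omega> \<inter> {x. u x = Z 0 x}" by (auto simp: S_def)
    ultimately show ?thesis by (simp add: closedin_closed_Int)
  qed
  moreover have "S \<noteq> {}" using x0 by (auto simp: S_def)
  ultimately have "S = \<Omega>" using conn unfolding connected_clopen by blast
  then show ?thesis using y by (auto simp: S_def)
qed

end

section \<open>Planar solutions\<close>

text \<open>Separation of variables: the solution is the inverse of an antiderivative
  \<open>T\<close> of \<open>1 / G\<close>. The upper bound on \<open>G\<close> makes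
  \<open>T\<close> grow at least like \<open>s / c\<close>, hence onto the real line, so the
  solution never escapes in finite time.\<close>

lemma autonomous_ode_exists:
  fixes G :: "real \<Rightarrow> real"
  assumes cont: "continuous_on UNIV G" and pos: "\<And>s. 0 < G s" and bd: "\<And>s. G s \<le> c"
  obtains w where "w t0 = s0" "\<And>t. (w has_real_derivative G (w t)) (at t)"
proof -
  have "\<exists>T. \<forall>s::real. -\<infinity> < ereal s \<longrightarrow> ereal s < \<infinity> \<longrightarrow> (T has_vector_derivative 1 / G s) (at s)"
    by (rule einterval_antiderivative)
       (use cont pos in \<open>auto intro!: continuous_intros simp: continuous_on_eq_continuous_at less_imp_neq[THEN not_sym]\<close>)
  then obtain T0 where T0: "\<And>s. (T0 has_real_derivative 1 / G s) (at s)"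
    by (auto simp: has_real_derivative_iff_has_vector_derivative)
  define T where "T s = T0 s - T0 s0 + t0" for s
  have T: "(T has_real_derivative 1 / G s) (at s)" for s
    unfolding T_def[abs_def] by (auto intro!: derivative_eq_intros T0)
  have cpos: "c > 0" using pos[of 0] bd[of 0] by linarith
  have contT: "continuous_on S T" for S
    using T by (meson DERIV_isCont continuous_at_imp_continuous_on)
  have grow: "T x + (y - x) / c \<le> T y" if "x \<le> y" for x y
  proof -
    have "T x - x / c \<le> T y - y / c"
    proof (rule DERIV_nonneg_imp_nondecreasing[OF that])
      fix s
      have "((\<lambda>s. T s - s / c) has_real_derivative 1 / G s - 1 / c) (at s)"
        using cpos by (auto intro!: derivative_eq_intros T)
      moreover have "1 / G s - 1 / c \<ge> 0" using pos[of s] bd[of s] by (simp add: frac_le)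
      ultimately show "\<exists>y. ((\<lambda>s. T s - s / c) has_real_derivative y) (at s) \<and> 0 \<le> y" by blast
    qed
    then show ?thesis by (simp add: diff_divide_distrib)
  qed
  have inj: "inj T"
  proof (rule linorder_injI)
    fix x y :: real assume "x < y"
    then have "(y - x) / c > 0" using cpos by simp
    then show "T x \<noteq> T y" using grow[of x y] \<open>x < y\<close> by linarith
  qed
  have surj: "\<exists>s. T s = y" for y
  proof -
    \<comment> \<open>The growth rate \<open>1 / c\<close> reaches the level \<open>y\<close> within
      distance \<open>M\<close> of 0.\<close>
    define M where "M = c * \<bar>y - T 0\<bar>"
    have M: "M \<ge> 0" "M / c = \<bar>y - T 0\<bar>" using cpos by (simp_all add: M_def)
    have "T 0 + M / c \<le> T M" "T (- M) + M / c \<le> T 0"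
      using grow[of 0 M] grow[of "- M" 0] M by simp_all
    then have "T (- M) \<le> y" "y \<le> T M" using M by linarith+
    then show ?thesis using IVT'[of T "- M" y M] contT M(1) by auto
  qed
  define w where "w = inv T"
  have Tw: "T (w t) = t" for t unfolding w_def using surj by (metis f_inv_into_f rangeI)
  have wT: "w (T s) = s" for s unfolding w_def using inj by simp
  show ?thesis
  proof
    show "w t0 = s0" using wT[of s0] by (simp add: T_def)
    fix t
    have "isCont w (T (w t))"
    proof (rule isCont_inverse_function[where f = T and d = 1])
      show "isCont T z" for z using T by (rule DERIV_isCont)
    qed (simp_all add: wT)
    then have "isCont w t" by (simp add: Tw)
    then have "(w has_real_derivative inverse (1 / G (w t))) (at t)"
      by (intro DERIV_inverse_function[where f = T and a = "t - 1" and b = "t + 1"] T)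
         (use pos[of "w t"] Tw in auto)
    then show "(w has_real_derivative G (w t)) (at t)" by simp
  qed
qed

text \<open>Each further derivative of a plane wave is again a plane wave, with a profile from the
  class \<open>P\<close>; differentiating along \<open>v\<close> produces the scalar
  \<open>e \<bullet> v\<close>, which is why \<open>P\<close> must admit constant factors.\<close>

lemma smooth_plane_wave:
  fixes e :: "'a::euclidean_space"
  assumes w: "P w" and deriv: "\<And>h. P h \<Longrightarrow> \<exists>h'. P h' \<and> (\<forall>t. (h has_real_derivative h' t) (at t))"
    and mult: "\<And>h k. P h \<Longrightarrow> P (\<lambda>t. k * h t)"
  shows "smooth (\<lambda>x. w (e \<bullet> x + \<tau>))"
proof -
  have D: "((\<lambda>x. h (e \<bullet> x + \<tau>)) has_derivative (\<lambda>v. (e \<bullet> v) * h' (e \<bullet> x + \<tau>))) (at x)"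
    if "\<And>t. (h has_real_derivative h' t) (at t)" for h h' x
  proof -
    have "((\<lambda>x. e \<bullet> x + \<tau>) has_derivative (\<lambda>v. e \<bullet> v)) (at x)"
      by (auto intro!: derivative_eq_intros)
    from has_derivative_compose[OF this that[unfolded has_field_derivative_def]]
    show ?thesis by (simp add: mult.commute)
  qed
  have "\<exists>h. P h \<and> dderiv (\<lambda>x. w (e \<bullet> x + \<tau>)) vs = (\<lambda>x. h (e \<bullet> x + \<tau>))" for vs
  proof (induction vs)
    case Nil
    show ?case using w by auto
  next
    case (Cons v vs)
    then obtain h where h: "P h" "dderiv (\<lambda>x. w (e \<bullet> x + \<tau>)) vs = (\<lambda>x. h (e \<bullet> x + \<tau>))" by blast
    obtain h' where h': "P h'" "\<And>t. (h has_real_derivative h' t) (at t)" using deriv[OF h(1)] by blast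
    have "dderiv (\<lambda>x. w (e \<bullet> x + \<tau>)) (v # vs) = (\<lambda>x. (e \<bullet> v) * h' (e \<bullet> x + \<tau>))"
      by (simp add: h(2) fderiv_eq[OF D[OF h'(2)]])
    then show ?case using mult[OF h'(1), of "e \<bullet> v"] by (intro exI[of _ "\<lambda>t. (e \<bullet> v) * h' t"]) auto
  qed
  note waves = this
  show ?thesis
    unfolding smooth_def
  proof (intro allI impI)
    fix vs x
    obtain h where h: "P h" "dderiv (\<lambda>x. w (e \<bullet> x + \<tau>)) vs = (\<lambda>x. h (e \<bullet> x + \<tau>))" using waves by blast
    obtain h' where "\<And>t. (h has_real_derivative h' t) (at t)" using deriv[OF h(1)] by blast
    then show "dderiv (\<lambda>x. w (e \<bullet> x + \<tau>)) vs differentiable at x"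
      unfolding h(2) by (rule differentiableI[OF D])
  qed
qed

text \<open>Functions of the profile variable obtained from a planar profile \<open>w\<close>, its slope \<open>g\<close> and
  the reciprocal ellipticity \<open>r\<close>; the class is closed under differentiation, whence smoothness.\<close>

inductive profile_fun :: "(real \<times> (real^'n) \<Rightarrow> real) \<Rightarrow> real^'n \<Rightarrow> (real \<Rightarrow> real) \<Rightarrow> (real \<Rightarrow> real)
    \<Rightarrow> (real \<Rightarrow> real) \<Rightarrow> (real \<Rightarrow> real) \<Rightarrow> bool" for a e w g r where
  const: "profile_fun a e w g r (\<lambda>t. k)"
| profile: "profile_fun a e w g r w"
| slope: "profile_fun a e w g r g"
| recip: "profile_fun a e w g r r"
| coef: "set vs \<subseteq> Basis \<Longrightarrow> profile_fun a e w g r (\<lambda>t. dderiv a vs (w t, g t *\<^sub>R e))"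
| add: "profile_fun a e w g r h1 \<Longrightarrow> profile_fun a e w g r h2 \<Longrightarrow> profile_fun a e w g r (\<lambda>t. h1 t + h2 t)"
| mult: "profile_fun a e w g r h1 \<Longrightarrow> profile_fun a e w g r h2 \<Longrightarrow> profile_fun a e w g r (\<lambda>t. h1 t * h2 t)"

lemma profile_fun_sum:
  assumes "\<And>i. i \<in> I \<Longrightarrow> profile_fun a e w g r (h i)"
  shows "profile_fun a e w g r (\<lambda>t. \<Sum>i\<in>I. h i t)"
  using assms
  by (induction I rule: infinite_finite_induct) (auto intro: profile_fun.const profile_fun.add)

text \<open>The chain rule is written with basis directions, so that every term is again a
  coefficient with a longer list and stays in \<open>profile_fun\<close>.\<close>

lemma DERIV_coef_profile:
  fixes a :: "real \<times> (real^'n) \<Rightarrow> real"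
  assumes a: "smooth a" and vs: "set vs \<subseteq> Basis"
    and w: "(w has_real_derivative w' t) (at t)" and g: "(g has_real_derivative g' t) (at t)"
  shows "((\<lambda>t. dderiv a vs (w t, g t *\<^sub>R e)) has_real_derivative
    w' t * dderiv a ((1, 0) # vs) (w t, g t *\<^sub>R e)
    + g' t * (\<Sum>i\<in>UNIV. e $ i * dderiv a ((0, axis i 1) # vs) (w t, g t *\<^sub>R e))) (at t)"
proof -
  let ?f = "dderiv a vs" and ?z = "(w t, g t *\<^sub>R e)"
  have C: "C1 ?f" using smooth_C1_dderiv[OF a vs] .
  have l: "linear (fderiv ?f ?z)" using C by (rule fderiv_linear)
  have "((\<lambda>t. (w t, g t *\<^sub>R e)) has_derivative (\<lambda>h. (w' t * h, (g' t * h) *\<^sub>R e))) (at t)"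
    using w g unfolding has_field_derivative_def by (auto intro!: derivative_eq_intros)
  from has_derivative_compose[OF this C1_has_derivative[OF C]]
  have "((\<lambda>t. ?f (w t, g t *\<^sub>R e)) has_derivative (\<lambda>h. fderiv ?f ?z (w' t * h, (g' t * h) *\<^sub>R e))) (at t)" .
  moreover have "fderiv ?f ?z (w' t * h, (g' t * h) *\<^sub>R e) =
     (w' t * fderiv ?f ?z (1, 0) + g' t * (\<Sum>i\<in>UNIV. e $ i * fderiv ?f ?z (0, axis i 1))) * h" for h
  proof -
    have "(w' t * h, (g' t * h) *\<^sub>R e) = (w' t * h) *\<^sub>R (1, 0) + (g' t * h) *\<^sub>R (0, e)" by simp
    also have "fderiv ?f ?z \<dots> = (w' t * h) * fderiv ?f ?z (1, 0) + (g' t * h) * fderiv ?f ?z (0, e)"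
      using l by (simp only: linear_add linear_cmul real_scaleR_def)
    also have "fderiv ?f ?z (0, e) = (\<Sum>i\<in>UNIV. e $ i * fderiv ?f ?z (0, axis i 1))"
      using fderiv_dp[OF C, of ?z e] by (simp add: dp_def inner_vec_def mult.commute)
    finally show ?thesis by (simp add: algebra_simps)
  qed
  ultimately show ?thesis by (simp add: has_field_derivative_def fun_eq_iff)
qed

section \<open>The scalar flux in a fixed direction and its inversion\<close>

context conductivity
begin

definition radial_flux :: "real^'n \<Rightarrow> real \<times> real \<Rightarrow> real" where
  "radial_flux e z = a (fst z, snd z *\<^sub>R e) * snd z"

text \<open>The derivative of \<open>radial_flux\<close> in its second variable. For a unit vector
  \<open>e\<close> it is the quadratic form of \<open>acoef\<close> evaluated at \<open>e\<close>,
  hence positive.\<close>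

definition radial_ellipticity :: "real^'n \<Rightarrow> real \<times> real \<Rightarrow> real" where
  "radial_ellipticity e z = a (fst z, snd z *\<^sub>R e) + snd z * (dp a (fst z, snd z *\<^sub>R e) \<bullet> e)"

lemma radial_ellipticity_pos:
  assumes "norm e = 1"
  shows "radial_ellipticity e z > 0"
proof -
  have "0 < lam0 \<bar>fst z\<bar>" by (rule lam0_pos) simp
  also have "\<dots> \<le> radial_ellipticity e z"
    using ellipticity[of "fst z" e "snd z *\<^sub>R e"] assms
    by (simp add: radial_ellipticity_def dot_square_norm algebra_simps)
  finally show ?thesis .
qed

lemma has_derivative_radial_flux:
  "(radial_flux e has_derivative
     (\<lambda>h. ds a (fst z, snd z *\<^sub>R e) * snd z * fst h + radial_ellipticity e z * snd h)) (at z)"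
proof -
  let ?y = "(fst z, snd z *\<^sub>R e)"
  have l: "linear (fderiv a ?y)" using C1_a by (rule fderiv_linear)
  have "((\<lambda>z. (fst z, snd z *\<^sub>R e)) has_derivative (\<lambda>h. (fst h, snd h *\<^sub>R e))) (at z)"
    by (auto intro!: derivative_eq_intros)
  from has_derivative_compose[OF this C1_has_derivative[OF C1_a]]
  have 1: "((\<lambda>z. a (fst z, snd z *\<^sub>R e)) has_derivative (\<lambda>h. fderiv a ?y (fst h, snd h *\<^sub>R e))) (at z)" .
  have "(snd has_derivative snd) (at z)" by (auto intro!: derivative_eq_intros)
  from has_derivative_mult[OF 1 this]
  have 2: "(radial_flux e has_derivative (\<lambda>h. a ?y * snd h + fderiv a ?y (fst h, snd h *\<^sub>R e) * snd z)) (at z)"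
    unfolding radial_flux_def[abs_def] .
  have 3: "fderiv a ?y (fst h, snd h *\<^sub>R e) = fst h * ds a ?y + snd h * (dp a ?y \<bullet> e)" for h :: "real \<times> real"
  proof -
    have "(fst h, snd h *\<^sub>R e) = fst h *\<^sub>R (1, 0) + snd h *\<^sub>R (0, e)" by simp
    also have "fderiv a ?y \<dots> = fst h * fderiv a ?y (1, 0) + snd h * fderiv a ?y (0, e)"
      using l by (simp only: linear_add linear_cmul real_scaleR_def)
    finally show ?thesis by (simp add: ds_def fderiv_dp[OF C1_a])
  qed
  show ?thesis
    using 2 unfolding 3 by (simp add: radial_ellipticity_def algebra_simps)
qed

lemma radial_flux_strict_mono:
  assumes "norm e = 1" "q1 < q2"
  shows "radial_flux e (s, q1) < radial_flux e (s, q2)"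
proof (rule DERIV_pos_imp_increasing[OF assms(2)])
  fix q :: real
  have "((\<lambda>q. (s, q)) has_derivative (\<lambda>k. (0, k))) (at q)"
    by (auto intro!: derivative_eq_intros)
  from has_derivative_compose[OF this has_derivative_radial_flux[where e = e and z = "(s, q)"]]
  have "((\<lambda>q. radial_flux e (s, q)) has_real_derivative radial_ellipticity e (s, q)) (at q)"
    by (simp add: has_field_derivative_def)
  then show "\<exists>y. ((\<lambda>q. radial_flux e (s, q)) has_real_derivative y) (at q) \<and> 0 < y"
    using radial_ellipticity_pos[OF assms(1)] by blast
qed

text \<open>\<open>G\<close> solves the flux equation for the slope. Because \<open>a\<close> is at
  least 1, the flux at slope \<open>c\<close> is already at least \<open>c\<close>, so the slope is
  found in the interval from 0 to \<open>c\<close>. Differentiability comes from the inverse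
  function theorem for \<open>H\<close>, which is globally injective by strict monotonicity:
  \<open>G\<close> is the second component of its inverse along the line of flux
  \<open>c\<close>.\<close>

lemma radial_flux_inverse:
  assumes e: "norm e = 1" and c: "c > 0"
  obtains G where "\<And>s. 0 < G s" "\<And>s. G s \<le> c" "\<And>s. radial_flux e (s, G s) = c"
    "\<And>s. (G has_real_derivative - (ds a (s, G s *\<^sub>R e) * G s / radial_ellipticity e (s, G s))) (at s)"
proof -
  have cF: "continuous_on S (radial_flux e)" for S
    using has_derivative_radial_flux by (meson continuous_at_imp_continuous_on has_derivative_continuous)
  have "\<exists>q. 0 < q \<and> q \<le> c \<and> radial_flux e (s, q) = c" for s
  proof -
    have "\<exists>q\<ge>0. q \<le> c \<and> radial_flux e (s, q) = c"
    proof (rule IVT')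
      show "radial_flux e (s, 0) \<le> c" using c by (simp add: radial_flux_def)
      have "1 * c \<le> a (s, c *\<^sub>R e) * c" using c a_ge_1 by (intro mult_right_mono) auto
      then show "c \<le> radial_flux e (s, c)" by (simp add: radial_flux_def)
      show "continuous_on {0..c} (\<lambda>q. radial_flux e (s, q))"
        by (rule continuous_on_compose2[OF cF[of UNIV]]) (auto intro!: continuous_intros)
    qed (use c in simp)
    then obtain q where q: "q \<ge> 0" "q \<le> c" "radial_flux e (s, q) = c" by auto
    moreover have "q \<noteq> 0" using q(3) c by (auto simp: radial_flux_def)
    ultimately show ?thesis by (intro exI[of _ q]) auto
  qed
  then obtain G where G: "\<And>s. 0 < G s" "\<And>s. G s \<le> c" "\<And>s. radial_flux e (s, G s) = c" by metis
  have uniq: "q = G s" if "radial_flux e (s, q) = c" for s q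
    using radial_flux_strict_mono[OF e, of q "G s" s] radial_flux_strict_mono[OF e, of "G s" q s] that G(3)[of s]
    by (cases q "G s" rule: linorder_cases) auto
  define H where "H z = (fst z, radial_flux e z)" for z :: "real \<times> real"
  have injH: "inj H"
  proof (rule injI)
    fix x y assume xy: "H x = H y"
    obtain s q where x: "x = (s, q)" by (cases x)
    obtain s' q' where y: "y = (s', q')" by (cases y)
    have "s = s'" "radial_flux e (s, q) = radial_flux e (s, q')" using xy by (auto simp: H_def x y)
    then have "q = q'"
      using radial_flux_strict_mono[OF e, of q q' s] radial_flux_strict_mono[OF e, of q' q s]
      by (cases q q' rule: linorder_cases) auto
    then show "x = y" using \<open>s = s'\<close> by (simp add: x y)
  qed
  show ?thesis
  proof (rule that[OF G])
    fix s
    let ?z = "(s, G s)"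
    let ?A = "ds a (s, G s *\<^sub>R e) * G s" and ?B = "radial_ellipticity e ?z"
    have B: "?B > 0" using e by (rule radial_ellipticity_pos)
    have "(inv H has_derivative (\<lambda>h. (fst h, (snd h - ?A * fst h) / ?B))) (at (H ?z))"
    proof (rule has_derivative_inverse_strong[where f = H and x = ?z and S = UNIV and f' = "\<lambda>h. (fst h, ?A * fst h + ?B * snd h)"])
      show "continuous_on UNIV H" unfolding H_def by (intro continuous_intros cF)
      show "(H has_derivative (\<lambda>h. (fst h, ?A * fst h + ?B * snd h))) (at ?z)"
        unfolding H_def[abs_def] using has_derivative_radial_flux[where e = e and z = ?z]
        by (auto intro!: has_derivative_Pair derivative_eq_intros)
      show "(\<lambda>h. (fst h, ?A * fst h + ?B * snd h)) \<circ> (\<lambda>h. (fst h, (snd h - ?A * fst h) / ?B)) = id"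
        using B by (auto simp: fun_eq_iff)
    qed (use injH in auto)
    then have 1: "(inv H has_derivative (\<lambda>h. (fst h, (snd h - ?A * fst h) / ?B))) (at (s, c))"
      by (simp add: H_def G(3))
    have "((\<lambda>s. (s, c)) has_derivative (\<lambda>h. (h, 0))) (at s)" by (auto intro!: derivative_eq_intros)
    from has_derivative_snd[OF has_derivative_compose[OF this 1]]
    have "((\<lambda>s. snd (inv H (s, c))) has_derivative (\<lambda>h. - (?A * h) / ?B)) (at s)" by simp
    moreover have "snd (inv H (s, c)) = G s" for s
    proof -
      have "inv H (H (s, G s)) = (s, G s)" using injH by simp
      then show ?thesis by (simp add: H_def G(3))
    qed
    ultimately have "(G has_derivative (\<lambda>h. - (?A * h) / ?B)) (at s)" by simp
    moreover have "(\<lambda>h. - (?A * h) / ?B) = (*) (- (?A / ?B))" by (simp add: fun_eq_iff)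
    ultimately show "(G has_real_derivative - (?A / ?B)) (at s)"
      by (simp only: has_field_derivative_def)
  qed
qed

text \<open>Solving the flux equation for the slope gives the autonomous equation
  \<open>w' = G(w)\<close>, whose solutions are global because \<open>G\<close> is at most
  \<open>c\<close>. Smoothness is a bootstrap: the derivatives of all generators of
  \<open>profile_fun\<close> lie in \<open>profile_fun\<close> again.\<close>

lemma planar_solution_exists:
  assumes e: "norm e = 1" and c: "c > 0"
  obtains w g where "w t0 = s0" "\<And>t. (w has_real_derivative g t) (at t)" "\<And>t. g t > 0"
    "\<And>t. a (w t, g t *\<^sub>R e) * g t = c" "\<And>\<tau>. smooth (\<lambda>x. w (e \<bullet> x + \<tau>))"
proof -
  obtain G where G: "\<And>s. 0 < G s" "\<And>s. G s \<le> c" "\<And>s. radial_flux e (s, G s) = c"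
    and G': "\<And>s. (G has_real_derivative - (ds a (s, G s *\<^sub>R e) * G s / radial_ellipticity e (s, G s))) (at s)"
    using radial_flux_inverse[OF e c] by blast
  have "continuous_on UNIV G" using G' by (meson DERIV_isCont continuous_at_imp_continuous_on)
  from autonomous_ode_exists[OF this G(1,2)]
  obtain w where w: "w t0 = s0" "\<And>t. (w has_real_derivative G (w t)) (at t)" by blast
  define g where "g t = G (w t)" for t
  have w': "(w has_real_derivative g t) (at t)" for t using w(2) by (simp add: g_def)
  define q where "q t = radial_ellipticity e (w t, g t)" for t
  have q: "q t > 0" for t unfolding q_def using e by (rule radial_ellipticity_pos)
  define r where "r t = inverse (q t)" for t
  let ?P = "profile_fun a e w g r"
  \<comment> \<open>The derivative of \<open>G\<close> along \<open>w\<close>, spelled as a product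
    of generators with \<open>r\<close> in place of a division.\<close>
  define g' where "g' t = (- 1) * (dderiv a [(1, 0)] (w t, g t *\<^sub>R e) * (g t * (g t * r t)))" for t
  have g: "(g has_real_derivative g' t) (at t)" for t
  proof -
    have "(g has_real_derivative - (ds a (w t, g t *\<^sub>R e) * g t / q t) * g t) (at t)"
      unfolding g_def[abs_def] q_def using DERIV_chain2[OF G' w(2)] .
    then show ?thesis by (simp add: g'_def ds_def r_def divide_inverse mult_ac)
  qed
  have B: "(1, 0) \<in> (Basis :: (real \<times> (real^'n)) set)" "(0, axis i 1) \<in> (Basis :: (real \<times> (real^'n)) set)" for i
    by (auto simp: Basis_prod_def axis_in_Basis_iff)
  have Pg': "?P g'" unfolding g'_def by (intro profile_fun.intros) (use B in auto)
  have closed_coef: "\<exists>h'. ?P h' \<and> (\<forall>t. ((\<lambda>t. dderiv a vs (w t, g t *\<^sub>R e)) has_real_derivative h' t) (at t))"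
    if "set vs \<subseteq> Basis" for vs
  proof (intro exI conjI allI)
    show "?P (\<lambda>t. g t * dderiv a ((1, 0) # vs) (w t, g t *\<^sub>R e)
       + g' t * (\<Sum>i\<in>UNIV. e $ i * dderiv a ((0, axis i 1) # vs) (w t, g t *\<^sub>R e)))"
      by (intro profile_fun.intros profile_fun_sum Pg') (use B that in auto)
  qed (rule DERIV_coef_profile[OF smooth_a that w' g])
  have add: "\<exists>h'. ?P h' \<and> (\<forall>t. ((\<lambda>t. h1 t + h2 t) has_real_derivative h' t) (at t))"
    if h1: "\<exists>h'. ?P h' \<and> (\<forall>t. (h1 has_real_derivative h' t) (at t))"
      and h2: "\<exists>h'. ?P h' \<and> (\<forall>t. (h2 has_real_derivative h' t) (at t))" for h1 h2
  proof -
    obtain h1' h2' where "?P h1'" "?P h2'" "\<And>t. (h1 has_real_derivative h1' t) (at t)"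
      "\<And>t. (h2 has_real_derivative h2' t) (at t)" using h1 h2 by blast
    then show ?thesis
      by (intro exI[of _ "\<lambda>t. h1' t + h2' t"] conjI allI DERIV_add profile_fun.add)
  qed
  have mult: "\<exists>h'. ?P h' \<and> (\<forall>t. ((\<lambda>t. h1 t * h2 t) has_real_derivative h' t) (at t))"
    if P: "?P h1" "?P h2" and h1: "\<exists>h'. ?P h' \<and> (\<forall>t. (h1 has_real_derivative h' t) (at t))"
      and h2: "\<exists>h'. ?P h' \<and> (\<forall>t. (h2 has_real_derivative h' t) (at t))" for h1 h2
  proof -
    obtain h1' h2' where "?P h1'" "?P h2'" "\<And>t. (h1 has_real_derivative h1' t) (at t)"
      "\<And>t. (h2 has_real_derivative h2' t) (at t)" using h1 h2 by blast
    then show ?thesis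
      by (intro exI[of _ "\<lambda>t. h1' t * h2 t + h2' t * h1 t"] conjI allI DERIV_mult profile_fun.add profile_fun.mult P)
  qed
  have cst: "\<exists>h'. ?P h' \<and> (\<forall>t. ((\<lambda>t. k) has_real_derivative h' t) (at t))" for k
    by (intro exI[of _ "\<lambda>t. 0"]) (auto intro: profile_fun.const)
  have slope: "\<exists>h'. ?P h' \<and> (\<forall>t. (g has_real_derivative h' t) (at t))" using Pg' g by blast
  define S where "S t = (\<Sum>i\<in>UNIV. e $ i * dderiv a [(0, axis i 1)] (w t, g t *\<^sub>R e))" for t
  have PS: "?P S" unfolding S_def by (intro profile_fun_sum profile_fun.intros) (use B in auto)
  \<comment> \<open>The empty list presents \<open>a\<close> itself as a coefficient of the
    class.\<close>
  have q_eq: "q = (\<lambda>t. dderiv a [] (w t, g t *\<^sub>R e) + g t * S t)"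
    by (simp add: q_def radial_ellipticity_def S_def dp_def inner_vec_def mult.commute fun_eq_iff)
  have dS: "\<exists>h'. ?P h' \<and> (\<forall>t. (S has_real_derivative h' t) (at t))"
  proof -
    have "\<forall>i. \<exists>h'. ?P h' \<and> (\<forall>t. ((\<lambda>t. dderiv a [(0, axis i 1)] (w t, g t *\<^sub>R e)) has_real_derivative h' t) (at t))"
      (is "\<forall>i. \<exists>h'. ?Q i h'")
    proof
      fix i
      have "set [(0, axis i 1)] \<subseteq> (Basis :: (real \<times> (real^'n)) set)" using B(2)[of i] by simp
      then show "\<exists>h'. ?Q i h'" by (rule closed_coef)
    qed
    from choice[OF this] obtain h' where "\<forall>i. ?Q i (h' i)" by blast
    then have h': "?P (h' i)"
      "((\<lambda>t. dderiv a [(0, axis i 1)] (w t, g t *\<^sub>R e)) has_real_derivative h' i t) (at t)" for i t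
      by blast+
    show ?thesis
    proof (intro exI conjI allI)
      show "?P (\<lambda>t. \<Sum>i\<in>UNIV. e $ i * h' i t)" by (intro profile_fun_sum profile_fun.mult profile_fun.const h')
      show "(S has_real_derivative (\<Sum>i\<in>UNIV. e $ i * h' i t)) (at t)" for t
        unfolding S_def[abs_def] by (intro DERIV_sum DERIV_cmult h')
    qed
  qed
  have "\<exists>h'. ?P h' \<and> (\<forall>t. (q has_real_derivative h' t) (at t))"
    unfolding q_eq by (intro add mult closed_coef slope dS profile_fun.slope PS) simp
  then obtain q' where q': "?P q'" "\<And>t. (q has_real_derivative q' t) (at t)" by blast
  have recip: "\<exists>h'. ?P h' \<and> (\<forall>t. (r has_real_derivative h' t) (at t))"
  proof (intro exI conjI allI)
    \<comment> \<open>The derivative of a reciprocal uses only the reciprocal and the derivative of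
      \<open>q\<close>, so the single generator \<open>r\<close> closes the class.\<close>
    show "?P (\<lambda>t. (- 1) * (r t * (q' t * r t)))" by (intro profile_fun.intros q')
    show "(r has_real_derivative (- 1) * (r t * (q' t * r t))) (at t)" for t
      unfolding r_def[abs_def] using DERIV_inverse'[OF q'(2), of t] q[of t] by (simp add: mult.assoc)
  qed
  have "\<exists>h'. ?P h' \<and> (\<forall>t. (h has_real_derivative h' t) (at t))" if "?P h" for h
    using that
  proof induction
    case profile
    then show ?case using w' profile_fun.slope by blast
  qed (blast intro: cst slope recip closed_coef add mult)+
  then have "smooth (\<lambda>x. w (e \<bullet> x + \<tau>))" for \<tau>
    by (intro smooth_plane_wave[where P = ?P]) (auto intro: profile_fun.intros)
  moreover have "a (w t, g t *\<^sub>R e) * g t = c" for t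
    using G(3)[of "w t"] by (simp add: g_def radial_flux_def)
  ultimately show ?thesis using that[of w g] w(1) w' G(1) by (simp add: g_def)
qed

lemma planar_grad_flux:
  assumes w: "\<And>t. (w has_real_derivative g t) (at t)" and c: "\<And>t. a (w t, g t *\<^sub>R e) * g t = c"
  shows "grad (\<lambda>x. w (e \<bullet> x + \<tau>)) x = g (e \<bullet> x + \<tau>) *\<^sub>R e"
    and "flux a (\<lambda>x. w (e \<bullet> x + \<tau>)) x = c *\<^sub>R e"
proof -
  have "((\<lambda>x. e \<bullet> x + \<tau>) has_derivative (\<lambda>v. e \<bullet> v)) (at x)"
    by (auto intro!: derivative_eq_intros)
  from has_derivative_compose[OF this w[unfolded has_field_derivative_def]]
  have "((\<lambda>x. w (e \<bullet> x + \<tau>)) has_derivative (\<lambda>v. g (e \<bullet> x + \<tau>) * (e \<bullet> v))) (at x)" .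
  then show g: "grad (\<lambda>x. w (e \<bullet> x + \<tau>)) x = g (e \<bullet> x + \<tau>) *\<^sub>R e"
    by (simp add: grad_def fderiv_eq vec_eq_iff inner_axis)
  show "flux a (\<lambda>x. w (e \<bullet> x + \<tau>)) x = c *\<^sub>R e"
    using c[of "e \<bullet> x + \<tau>"] by (simp add: flux_def g)
qed

end

section \<open>Recovering the conductivity from the Dirichlet-to-Neumann map\<close>

text \<open>Uniqueness determines solutions only inside the domain. Continuity of the gradient
  transfers this to the frontier, where the flux is read off.\<close>

lemma eq_on_open_imp_eq_on_closure:
  fixes u z :: "real^'n \<Rightarrow> real"
  assumes su: "smooth u" and sz: "smooth z" and \<Omega>: "open \<Omega>" and eq: "\<And>x. x \<in> \<Omega> \<Longrightarrow> u x = z x"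
    and x: "x \<in> closure \<Omega>"
  shows "u x = z x" "grad u x = grad z x"
proof -
  have "closed {x. u x = z x}"
    by (intro closed_Collect_eq C1_continuous smooth_C1 su sz)
  then have "closure \<Omega> \<subseteq> {x. u x = z x}" using eq by (intro closure_minimal) auto
  then show "u x = z x" using x by auto
  have "grad u y = grad z y" if "y \<in> \<Omega>" for y
  proof -
    have "u differentiable at y" using smooth_C1[OF su] by (simp add: C1_def)
    from frechet_derivative_transform_within_open[OF this \<Omega> that eq]
    show ?thesis by (simp add: grad_def)
  qed
  moreover have "closed {x. grad u x = grad z x}"
    by (intro closed_Collect_eq C1_field_continuous smooth_C1_field_grad su sz)
  ultimately have "closure \<Omega> \<subseteq> {x. grad u x = grad z x}" by (intro closure_minimal) auto
  then show "grad u x = grad z x" using x by auto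
qed

text \<open>In dimension at least 2 a line orthogonal to \<open>e\<close> passes through
  \<open>y\<close>; it leaves the bounded set and so crosses the frontier at the same level. Thus
  every level attained inside is visible in the boundary data.\<close>

lemma hyperplane_meets_frontier:
  fixes e :: "'a::euclidean_space"
  assumes dim: "DIM('a) \<ge> 2" and "bounded \<Omega>" and y: "y \<in> \<Omega>"
  obtains x where "x \<in> frontier \<Omega>" "e \<bullet> x = e \<bullet> y"
proof -
  obtain v where v: "v \<noteq> 0" "orthogonal e v" using orthogonal_to_vector_exists[OF dim] by blast
  obtain M where M: "\<forall>x\<in>\<Omega>. norm x \<le> M" using \<open>bounded \<Omega>\<close> unfolding bounded_iff by blast
  let ?S = "range (\<lambda>k. y + k *\<^sub>R v)"
  define k where "k = (\<bar>M\<bar> + norm y + 1) / norm v"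
  have "norm (k *\<^sub>R v) = \<bar>M\<bar> + norm y + 1" using v(1) by (simp add: k_def)
  then have "norm (y + k *\<^sub>R v) > M"
    using norm_triangle_ineq4[of "y + k *\<^sub>R v" y] by simp
  then have "y + k *\<^sub>R v \<notin> \<Omega>" using M by fastforce
  then have 1: "?S - \<Omega> \<noteq> {}" by blast
  have "y = y + 0 *\<^sub>R v" by simp
  then have 2: "?S \<inter> \<Omega> \<noteq> {}" using y by blast
  have 3: "connected ?S"
    by (intro connected_continuous_image continuous_intros) auto
  from connected_Int_frontier[OF 3 2 1] obtain k where "y + k *\<^sub>R v \<in> frontier \<Omega>" by blast
  moreover have "e \<bullet> (y + k *\<^sub>R v) = e \<bullet> y" using v(2) by (simp add: inner_add_right orthogonal_def)
  ultimately show ?thesis using that by blast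
qed

text \<open>The constant field \<open>V\<close> is divergence free and tangential. Testing it with
  the linear function \<open>V \<bullet> x\<close> gives \<open>|V|^2\<close> times the volume equal
  to zero.\<close>

lemma (in level_domain) constant_flux_determined:
  assumes ne: "\<Omega> \<noteq> {}" and V: "\<And>x. x \<in> frontier \<Omega> \<Longrightarrow> grad \<rho> x \<bullet> V = 0"
  shows "V = 0"
proof -
  have dV: "div_field (\<lambda>x. V) x = 0" for x by (simp add: div_field_def)
  have "(LINT x:\<Omega>|lborel. fderiv (\<lambda>x. V \<bullet> x) x V + (V \<bullet> x) * div_field (\<lambda>x. V) x) = 0"
    by (rule integration_by_parts[OF C1_inner]) (use V in \<open>auto simp: C1_field_def C1_const\<close>)
  then have "(LINT x:\<Omega>|lborel. V \<bullet> V) = 0" by (simp add: dV fderiv_inner)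
  then have z: "measure lborel \<Omega> * (V \<bullet> V) = 0" by (simp add: set_lebesgue_integral_def)
  obtain x r where r: "r > 0" "ball x r \<subseteq> \<Omega>" using ne open_domain by (meson all_not_in_conv openE)
  have "0 < measure lborel (ball x r)" using content_ball_pos[OF r(1)] by simp
  also have "\<dots> \<le> measure lborel \<Omega>"
    using r(2) open_domain bounded
    by (intro measure_mono_fmeasurable fmeasurableI emeasure_bounded_finite) auto
  finally show ?thesis using z by simp
qed

context dirichlet_problem
begin

lemma is_solution_iff:
  "is_solution \<Omega> a f u \<longleftrightarrow> solves u \<and> (\<forall>x\<in>frontier \<Omega>. u x = f x)"
proof -
  have "(\<lambda>y. a (u y, grad u y) *\<^sub>R grad u y) = flux a u" by (simp add: flux_def fun_eq_iff)
  then show ?thesis by (simp add: is_solution_def solves_def)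
qed

lemma planar_solves:
  assumes w: "\<And>t. (w has_real_derivative g t) (at t)" and c: "\<And>t. a (w t, g t *\<^sub>R e) * g t = c"
    and sm: "smooth (\<lambda>x. w (e \<bullet> x + \<tau>))"
  shows "solves (\<lambda>x. w (e \<bullet> x + \<tau>))"
proof -
  have "flux a (\<lambda>x. w (e \<bullet> x + \<tau>)) = (\<lambda>x. c *\<^sub>R e)"
    using planar_grad_flux(2)[OF w c] by (simp add: fun_eq_iff)
  then show ?thesis using sm by (simp add: solves_def div_field_def)
qed

text \<open>The choice operator may return a function other than \<open>z\<close>, but Dirichlet
  uniqueness forces it to agree with \<open>z\<close> on the closure, gradients included.\<close>

lemma dn_map_unique_solution:
  assumes z: "solves z" and x: "x \<in> frontier \<Omega>"
  shows "dn_map \<Omega> a z x = flux a z x \<bullet> outer_normal \<Omega> x"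
proof -
  define u where "u = (SOME u. is_solution \<Omega> a z u)"
  have "is_solution \<Omega> a z z" using z by (simp add: is_solution_iff)
  then have "is_solution \<Omega> a z u" unfolding u_def by (rule someI[of "is_solution \<Omega> a z"])
  then have u: "solves u" "\<And>x. x \<in> frontier \<Omega> \<Longrightarrow> u x = z x" by (auto simp: is_solution_iff)
  have s: "smooth u" "smooth z" using u(1) z by (auto simp: solves_def)
  have "x \<in> closure \<Omega>" using x by (simp add: frontier_def)
  then have "u x = z x" "grad u x = grad z x"
    using eq_on_open_imp_eq_on_closure[OF s open_domain dirichlet_uniqueness[OF u(1) z u(2)]] by auto
  then show ?thesis by (simp add: dn_map_def u_def[symmetric] Let_def flux_def)
qed

end

text \<open>\<open>rho_eq\<close> selects the defining function used by \<open>outer_normal\<close>,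
  so that the normal is the normalised \<open>grad \<rho>\<close> and boundary fluxes can be
  compared with either.\<close>

locale two_conductivities =
  D: dirichlet_problem \<Omega> \<rho> a lam lam0 mu0 B + D': dirichlet_problem \<Omega> \<rho> a' lam lam0 mu0 B
  for \<Omega> :: "(real^'n) set" and \<rho> and a a' :: "real \<times> (real^'n) \<Rightarrow> real" and lam lam0 mu0 B +
  assumes dim: "CARD('n) \<ge> 2" and conn: "connected \<Omega>" and ne: "\<Omega> \<noteq> {}"
    and rho_eq: "\<rho> = (SOME \<rho>. defining_function \<rho> \<Omega>)"
    and dn_eq: "\<And>f x. smooth f \<Longrightarrow> x \<in> frontier \<Omega> \<Longrightarrow> dn_map \<Omega> a f x = dn_map \<Omega> a' f x"
begin

lemma normal_inner_iff:
  assumes "x \<in> frontier \<Omega>"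
  shows "V \<bullet> outer_normal \<Omega> x = W \<bullet> outer_normal \<Omega> x \<longleftrightarrow> grad \<rho> x \<bullet> V = grad \<rho> x \<bullet> W"
proof -
  have "V \<bullet> outer_normal \<Omega> x = (grad \<rho> x \<bullet> V) / norm (grad \<rho> x)" for V
    unfolding outer_normal_def rho_eq[symmetric] Let_def by (simp add: inner_commute)
  then show ?thesis using D.grad_rho_frontier[OF assms] by simp
qed

text \<open>If the second problem has no solution for the data \<open>f\<close>, then \<open>SOME u. is_solution \<Omega> a' f u\<close>
  is the choice from the empty predicate, hence one fixed function whatever \<open>f\<close> is. A flux vector
  \<open>V\<close> is called bad if the planar solution with that flux could be in this situation.\<close>

definition bad :: "real^'n \<Rightarrow> bool" where
  "bad V \<longleftrightarrow> (\<forall>x\<in>frontier \<Omega>. V \<bullet> outer_normal \<Omega> x = flux a' (SOME u. False) x \<bullet> outer_normal \<Omega> x)"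

lemma bad_unique: "bad V \<Longrightarrow> bad W \<Longrightarrow> V = W"
proof -
  assume "bad V" "bad W"
  then have "V \<bullet> outer_normal \<Omega> x = W \<bullet> outer_normal \<Omega> x" if "x \<in> frontier \<Omega>" for x
    using that by (simp add: bad_def)
  then have "grad \<rho> x \<bullet> (V - W) = 0" if "x \<in> frontier \<Omega>" for x
    using normal_inner_iff[OF that, of V W] that by (simp add: inner_diff_right)
  then show ?thesis using D.constant_flux_determined[OF ne, of "V - W"] by simp
qed

lemma agree_not_bad:
  assumes p: "p \<noteq> 0" and good: "\<not> bad (a (s, p) *\<^sub>R p)"
  shows "a (s, p) = a' (s, p)"
proof -
  define e where "e = (1 / norm p) *\<^sub>R p"
  \<comment> \<open>The flux carried by the gradient \<open>p\<close> at value \<open>s\<close>.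
    Strict monotonicity of \<open>radial_flux\<close> later recovers \<open>norm p\<close> as the
    slope of the profile where it takes the value \<open>s\<close>.\<close>
  define c where "c = a (s, p) * norm p"
  have e: "norm e = 1" and pe: "p = norm p *\<^sub>R e" using p by (simp_all add: e_def)
  have c: "c > 0" using p D.a_ge_1[of s p] by (simp add: c_def)
  have ce: "a (s, p) *\<^sub>R p = c *\<^sub>R e" using p by (simp add: c_def e_def)
  obtain x0 where x0: "x0 \<in> \<Omega>" using ne by blast
  obtain w g where w: "w (e \<bullet> x0) = s" "\<And>t. (w has_real_derivative g t) (at t)" "\<And>t. g t > 0"
    "\<And>t. a (w t, g t *\<^sub>R e) * g t = c" "\<And>\<tau>. smooth (\<lambda>x. w (e \<bullet> x + \<tau>))"
    using D.planar_solution_exists[OF e c] by blast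
  define f where "f x = w (e \<bullet> x)" for x
  have f: "D.solves f" and ff: "flux a f x = c *\<^sub>R e" for x
    using D.planar_solves[OF w(2,4,5), of 0] D.planar_grad_flux(2)[OF w(2,4), of 0] by (simp_all add: f_def[abs_def])
  have sf: "smooth f" using f by (simp add: D.solves_def)
  have dn: "dn_map \<Omega> a' f x = c *\<^sub>R e \<bullet> outer_normal \<Omega> x" if "x \<in> frontier \<Omega>" for x
    using D.dn_map_unique_solution[OF f that] dn_eq[OF sf that] by (simp only: ff)
  define u where "u = (SOME u. is_solution \<Omega> a' f u)"
  have dnu: "dn_map \<Omega> a' f x = flux a' u x \<bullet> outer_normal \<Omega> x" for x
    by (simp add: dn_map_def u_def[symmetric] Let_def flux_def)
  have "\<exists>u. is_solution \<Omega> a' f u"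
  proof (rule ccontr)
    assume "\<not> (\<exists>u. is_solution \<Omega> a' f u)"
    then have "u = (SOME u. False)" by (simp add: u_def)
    then have "bad (c *\<^sub>R e)" unfolding bad_def using dn dnu by metis
    then show False using good ce by simp
  qed
  then have "is_solution \<Omega> a' f u" unfolding u_def by (rule someI_ex)
  then have u: "D'.solves u" "\<And>x. x \<in> frontier \<Omega> \<Longrightarrow> u x = f x" by (auto simp: D'.is_solution_iff)
  \<comment> \<open>Passing through the value of \<open>u\<close> at \<open>x0\<close> supplies the
    contact point that Neumann uniqueness starts from.\<close>
  obtain w' g' where w': "w' (e \<bullet> x0) = u x0" "\<And>t. (w' has_real_derivative g' t) (at t)" "\<And>t. g' t > 0"
    "\<And>t. a' (w' t, g' t *\<^sub>R e) * g' t = c" "\<And>\<tau>. smooth (\<lambda>x. w' (e \<bullet> x + \<tau>))"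
    using D'.planar_solution_exists[OF e c] by blast
  \<comment> \<open>Shifting the profile variable keeps the flux \<open>c *\<^sub>R e\<close> and,
    the slope being positive, moves the solution strictly upwards.\<close>
  define Z where "Z \<tau> x = w' (e \<bullet> x + \<tau>)" for \<tau> x
  have Z: "D'.solves (Z \<tau>)" and fZ: "flux a' (Z \<tau>) x = c *\<^sub>R e" for \<tau> x
    using D'.planar_solves[OF w'(2,4,5)] D'.planar_grad_flux(2)[OF w'(2,4)] by (simp_all add: Z_def[abs_def])
  have mono: "strict_mono w'"
  proof (rule strict_monoI)
    fix x y :: real assume "x < y"
    then show "w' x < w' y"
      by (rule DERIV_pos_imp_increasing) (rule exI[of _ "g' t" for t], rule conjI[OF w'(2,3)])
  qed
  have uZ: "u y = Z 0 y" if y: "y \<in> \<Omega>" for y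
  proof (rule D'.neumann_uniqueness[OF conn u(1) Z _ _ _ x0 _ y])
    fix \<tau> x assume x: "x \<in> frontier \<Omega>"
    have "flux a' u x \<bullet> outer_normal \<Omega> x = c *\<^sub>R e \<bullet> outer_normal \<Omega> x" using dn[OF x] dnu by simp
    then show "grad \<rho> x \<bullet> flux a' u x = grad \<rho> x \<bullet> flux a' (Z \<tau>) x"
      unfolding fZ using normal_inner_iff[OF x] by blast
  next
    fix x
    show "strict_mono (\<lambda>\<tau>. Z \<tau> x)"
      unfolding Z_def by (intro strict_monoI strict_monoD[OF mono]) simp
    have "isCont (\<lambda>\<tau>. e \<bullet> x + \<tau>) 0" by simp
    from isCont_o2[OF this DERIV_isCont[OF w'(2)]]
    show "isCont (\<lambda>\<tau>. Z \<tau> x) 0" unfolding Z_def .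
  qed (simp add: Z_def w')
  have eq: "w (e \<bullet> x) = w' (e \<bullet> x)" if x: "x \<in> frontier \<Omega>" for x
  proof -
    have s: "smooth u" "smooth (Z 0)" using u(1) Z[of 0] by (auto simp: D'.solves_def)
    have "x \<in> closure \<Omega>" using x by (simp add: frontier_def)
    then have "u x = Z 0 x" by (rule eq_on_open_imp_eq_on_closure(1)[OF s D.open_domain, rotated]) (rule uZ)
    then show ?thesis using u(2)[OF x] by (simp add: f_def Z_def)
  qed
  define t0 where "t0 = e \<bullet> x0"
  obtain r where r: "r > 0" "ball x0 r \<subseteq> \<Omega>" using D.open_domain x0 by (meson openE)
  \<comment> \<open>The profiles are compared only at levels attained on the frontier. All levels
    near \<open>t0\<close> are attained there, which gives an interval of agreement and hence equal
    slopes at \<open>t0\<close>.\<close>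
  have weq: "w t = w' t" if t: "t \<in> ball t0 r" for t
  proof -
    have "norm ((t - t0) *\<^sub>R e) < r" using t e by (simp add: dist_real_def abs_minus_commute)
    then have "x0 + (t - t0) *\<^sub>R e \<in> \<Omega>" using r(2) by (auto simp: dist_norm)
    then obtain x where "x \<in> frontier \<Omega>" "e \<bullet> x = e \<bullet> (x0 + (t - t0) *\<^sub>R e)"
      using hyperplane_meets_frontier[OF _ D.bounded] dim by auto
    moreover have "e \<bullet> (x0 + (t - t0) *\<^sub>R e) = t"
      using e by (simp add: inner_add_right t0_def dot_square_norm)
    ultimately show ?thesis using eq by metis
  qed
  have t0: "t0 \<in> ball t0 r" using r(1) by simp
  have "(w' has_real_derivative g t0) (at t0)"
    using has_field_derivative_transform_within_open[OF w(2) open_ball t0 weq] .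
  then have gg: "g t0 = g' t0" using w'(2) DERIV_unique by blast
  have ws: "w t0 = s" "w' t0 = s" using w(1) weq[OF t0] by (simp_all add: t0_def)
  have "D.radial_flux e (s, g t0) = D.radial_flux e (s, norm p)"
    using w(4)[of t0] pe by (simp add: ws D.radial_flux_def c_def)
  then have "g t0 = norm p"
    using D.radial_flux_strict_mono[OF e, of "g t0" "norm p" s] D.radial_flux_strict_mono[OF e, of "norm p" "g t0" s]
    by (cases "g t0" "norm p" rule: linorder_cases) auto
  then have "a (s, p) * norm p = c" "a' (s, p) * norm p = c"
    using w(4)[of t0] w'(4)[of t0] gg pe by (simp_all add: ws)
  then have "a (s, p) * norm p = a' (s, p) * norm p" by (simp only:)
  then show ?thesis using p by (simp only: mult_cancel_right norm_eq_zero simp_thms)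
qed

text \<open>Along the ray through \<open>p\<close> the flux is strictly increasing, so the slightly
  longer vectors \<open>q k\<close> have fluxes different from a bad one and are therefore good;
  continuity brings the equality back to \<open>p\<close>.\<close>

lemma agree_nonzero:
  assumes p: "p \<noteq> 0"
  shows "a (s, p) = a' (s, p)"
proof (cases "bad (a (s, p) *\<^sub>R p)")
  case True
  define e where "e = (1 / norm p) *\<^sub>R p"
  have e: "norm e = 1" and pe: "p = norm p *\<^sub>R e" using p by (simp_all add: e_def)
  define q where "q k = (1 + 1 / real (Suc k)) *\<^sub>R p" for k
  have qe: "q k = ((1 + 1 / real (Suc k)) * norm p) *\<^sub>R e" for k
    using p by (simp add: q_def e_def)
  have agree: "a (s, q k) = a' (s, q k)" for k
  proof (rule agree_not_bad)
    have pos: "1 + 1 / real (Suc k) > 1" by simp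
    then have "1 + 1 / real (Suc k) \<noteq> 0" by linarith
    then show "q k \<noteq> 0" using p unfolding q_def by simp
    show "\<not> bad (a (s, q k) *\<^sub>R q k)"
    proof
      assume "bad (a (s, q k) *\<^sub>R q k)"
      then have "a (s, q k) *\<^sub>R q k = a (s, p) *\<^sub>R p" using True by (rule bad_unique)
      then have "D.radial_flux e (s, (1 + 1 / real (Suc k)) * norm p) *\<^sub>R e = D.radial_flux e (s, norm p) *\<^sub>R e"
        unfolding D.radial_flux_def fst_conv snd_conv qe[symmetric] pe[symmetric]
        by (metis pe qe scaleR_scaleR)
      moreover have "e \<noteq> 0" using e by auto
      ultimately have "D.radial_flux e (s, (1 + 1 / real (Suc k)) * norm p) = D.radial_flux e (s, norm p)" by simp
      moreover have "norm p < (1 + 1 / real (Suc k)) * norm p"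
        using p mult_strict_right_mono[OF pos, of "norm p"] by simp
      then have "D.radial_flux e (s, norm p) < D.radial_flux e (s, (1 + 1 / real (Suc k)) * norm p)"
        by (rule D.radial_flux_strict_mono[OF e])
      ultimately show False by simp
    qed
  qed
  have "(\<lambda>k. 1 / real (Suc k)) \<longlonglongrightarrow> 0"
    using LIMSEQ_inverse_real_of_nat by (simp add: divide_inverse)
  then have "(\<lambda>k. (s, q k)) \<longlonglongrightarrow> (s, (1 + 0) *\<^sub>R p)"
    unfolding q_def by (intro tendsto_intros)
  then have lim: "(\<lambda>k. (s, q k)) \<longlonglongrightarrow> (s, p)" by simp
  have "isCont a z" "isCont a' z" for z
    using C1_has_derivative[OF D.C1_a] C1_has_derivative[OF D'.C1_a] has_derivative_continuous by blast+
  then have "(\<lambda>k. a (s, q k)) \<longlonglongrightarrow> a (s, p)" "(\<lambda>k. a' (s, q k)) \<longlonglongrightarrow> a' (s, p)"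
    using isCont_tendsto_compose[OF _ lim] by blast+
  then show ?thesis unfolding agree by (rule LIMSEQ_unique)
qed (rule agree_not_bad[OF p])

text \<open>Profiles of positive flux have positive slope and never reach \<open>p = 0\<close>,
  which is attained as a limit.\<close>

lemma agree: "a (s, p) = a' (s, p)"
proof (cases "p = 0")
  case True
  define v :: "real^'n" where "v = axis undefined 1"
  define q where "q k = (1 / real (Suc k)) *\<^sub>R v" for k
  have "v \<noteq> 0" by (simp add: v_def axis_eq_0_iff)
  then have q: "a (s, q k) = a' (s, q k)" for k by (intro agree_nonzero) (simp add: q_def)
  have "(\<lambda>k. 1 / real (Suc k)) \<longlonglongrightarrow> 0"
    using LIMSEQ_inverse_real_of_nat by (simp add: divide_inverse)
  then have "(\<lambda>k. (s, q k)) \<longlonglongrightarrow> (s, 0 *\<^sub>R v)"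
    unfolding q_def by (intro tendsto_intros)
  then have lim: "(\<lambda>k. (s, q k)) \<longlonglongrightarrow> (s, p)" using True by simp
  have "isCont a z" "isCont a' z" for z
    using C1_has_derivative[OF D.C1_a] C1_has_derivative[OF D'.C1_a] has_derivative_continuous by blast+
  then have "(\<lambda>k. a (s, q k)) \<longlonglongrightarrow> a (s, p)" "(\<lambda>k. a' (s, q k)) \<longlonglongrightarrow> a' (s, p)"
    using isCont_tendsto_compose[OF _ lim] by blast+
  then show ?thesis unfolding q by (rule LIMSEQ_unique)
qed (rule agree_nonzero)

end

theorem theorem1:
  fixes \<Omega> :: "(real^'n) set"
    and lam :: "real \<times> (real^'n) \<Rightarrow> real"
    and lam0 mu0 :: "real \<Rightarrow> real"
    and B :: "nat \<Rightarrow> (real \<times> (real^'n)) set \<Rightarrow> real"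
  assumes "CARD('n) \<ge> 2"
    and "smooth_bounded_domain \<Omega>"
    and "\<forall>t\<ge>0. lam0 t > 0" and "antimono_on {0..} lam0"
    and "\<forall>t\<ge>0. mu0 t > 0" and "mono_on {0..} mu0"
  shows "\<exists>PiF::real \<Rightarrow> real. continuous_on UNIV PiF \<and> (\<forall>s. PiF s > 0) \<and>
    (\<forall>a a'. admissible lam lam0 mu0 B a \<and> admissible lam lam0 mu0 B a'
       \<and> (\<forall>f. smooth f \<longrightarrow> (\<forall>x\<in>frontier \<Omega>. dn_map \<Omega> a f x = dn_map \<Omega> a' f x))
       \<longrightarrow> (\<forall>s p. norm p < PiF s \<longrightarrow> a (s, p) = a' (s, p)))"
proof (intro exI[of _ "\<lambda>_. 1"] conjI allI impI)
  fix a a' s p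
  assume h: "admissible lam lam0 mu0 B a \<and> admissible lam lam0 mu0 B a'
       \<and> (\<forall>f. smooth f \<longrightarrow> (\<forall>x\<in>frontier \<Omega>. dn_map \<Omega> a f x = dn_map \<Omega> a' f x))"
  define \<rho> where "\<rho> = (SOME \<rho>. defining_function \<rho> \<Omega>)"
  have dom: "bounded \<Omega>" "connected \<Omega>" "\<Omega> \<noteq> {}" "\<exists>\<rho>. defining_function \<rho> \<Omega>"
    using assms(2) by (auto simp: smooth_bounded_domain_def)
  have \<rho>: "defining_function \<rho> \<Omega>" unfolding \<rho>_def using dom(4) by (rule someI_ex)
  interpret two_conductivities \<Omega> \<rho> a a' lam lam0 mu0 B
    by unfold_locales (use assms h dom \<rho> in \<open>auto simp: \<rho>_def\<close>)
  show "a (s, p) = a' (s, p)" by (rule agree)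
qed auto

end
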